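(* Let $n\ge1$, $s\in(0,1)$, $a=1-2s$. Every solution $(u,v)$ of $$\begin{cases} L_a u=L_a v=0 & \text{in } \mathbb{R}^{n+1}_+,\\ \partial_y^a u=uv^2,\quad \partial_y^a v=vu^2 & \text{on } \partial\mathbb{R}^{n+1}_+\end{cases}$$ has at most polynomial growth: there exist $d>0$ and a constant $C$ such that $$u(z)+v(z)\le C(1+|x|+|y|)^d\quad\text{for all } z=(x,y)\in\mathbb{R}^{n+1}_+ .$$
   Context: $\mathbb{R}^{n+1}_+=\{z=(x,y): x\in\mathbb{R}^n,\ y>0\}$. $L_a w=\mathrm{div}(y^a\nabla w)$, and on $\{y=0\}$, $\partial_y^a w(x)=\lim_{y\to0^+}y^a\frac{\partial w}{\partial y}(x,y)$. A solution $(u,v)$ means a pair of functions with $u,v>0$ on $\overline{\mathbb{R}^{n+1}_+}$, continuous on $\overline{\mathbb{R}^{n+1}_+}$, with $\int_{K}y^a(w^2+|\nabla w|^2)<\infty$ for $w=u,v$ and every bounded $K\subset\mathbb{R}^{n+1}_+$, satisfying the system. *)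

theory Defs
  imports "HOL-Analysis.Analysis"
begin

text \<open>
  Points of \<open>\<real>\<^sup>n\<^sup>+\<^sup>1\<close> are pairs \<open>z = (x, y)\<close> of type \<open>(real ^ 'n) \<times> real\<close> with \<open>n = CARD('n) \<ge> 1\<close>.
  Functions are total in HOL, but only their values on the closed half-space matter below.
\<close>

definition half_space :: "((real ^ 'n) \<times> real) set" where
  "half_space = {z. snd z > 0}"

definition closed_half_space :: "((real ^ 'n) \<times> real) set" where
  "closed_half_space = {z. snd z \<ge> 0}"

definition gradient :: "('a::real_inner \<Rightarrow> real) \<Rightarrow> 'a \<Rightarrow> 'a" where
  "gradient f z = (THE g. GDERIV f z :> g)"

definition divergence :: "('a::euclidean_space \<Rightarrow> 'a) \<Rightarrow> 'a \<Rightarrow> real" where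
  "divergence F z = (\<Sum>b\<in>Basis. frechet_derivative F (at z) b \<bullet> b)"

text \<open>Intended for open \<open>S\<close>: the derivatives are unrestricted ones.\<close>

definition C2_on :: "'a::real_normed_vector set \<Rightarrow> ('a \<Rightarrow> real) \<Rightarrow> bool" where
  "C2_on S f \<longleftrightarrow> (\<exists>(f' :: 'a \<Rightarrow> 'a \<Rightarrow>\<^sub>L real) (f'' :: 'a \<Rightarrow> 'a \<Rightarrow>\<^sub>L ('a \<Rightarrow>\<^sub>L real)).
     (\<forall>z\<in>S. (f has_derivative blinfun_apply (f' z)) (at z)) \<and>
     (\<forall>z\<in>S. (f' has_derivative blinfun_apply (f'' z)) (at z)) \<and>
     continuous_on S f'')"

definition L_op :: "real \<Rightarrow> ((real ^ 'n) \<times> real \<Rightarrow> real) \<Rightarrow> (real ^ 'n) \<times> real \<Rightarrow> real" where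
  "L_op a w = divergence (\<lambda>z. (snd z powr a) *\<^sub>R gradient w z)"

text \<open>
  \<open>has_weighted_normal_deriv a w x l\<close> says that the limit \<open>\<partial>\<^sub>y\<^sup>a w(x)\<close> exists and equals \<open>l\<close>.
\<close>

definition has_weighted_normal_deriv ::
    "real \<Rightarrow> ((real ^ 'n) \<times> real \<Rightarrow> real) \<Rightarrow> real ^ 'n \<Rightarrow> real \<Rightarrow> bool" where
  "has_weighted_normal_deriv a w x l \<longleftrightarrow>
     ((\<lambda>y. y powr a * deriv (\<lambda>t. w (x, t)) y) \<longlongrightarrow> l) (at_right 0)"

definition locally_finite_energy :: "real \<Rightarrow> ((real ^ 'n) \<times> real \<Rightarrow> real) \<Rightarrow> bool" where
  "locally_finite_energy a w \<longleftrightarrow>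
     (\<forall>K\<in>sets lebesgue. bounded K \<and> K \<subseteq> half_space \<longrightarrow>
        (\<lambda>z. snd z powr a * ((w z)\<^sup>2 + (norm (gradient w z))\<^sup>2)) absolutely_integrable_on K)"

text \<open>
  The equation in the open half-space is understood classically, for \<open>C\<^sup>2\<close> functions; since \<open>L\<^sub>a\<close>
  is uniformly elliptic with smooth coefficients on compact subsets of the open half-space,
  weak solutions are classical there. The sets \<open>K\<close> in the energy condition may touch the
  boundary \<open>{y = 0}\<close>, and the boundary conditions hold at every boundary point.
\<close>

definition is_solution ::
    "real \<Rightarrow> ((real ^ 'n) \<times> real \<Rightarrow> real) \<Rightarrow> ((real ^ 'n) \<times> real \<Rightarrow> real) \<Rightarrow> bool" where
  "is_solution a u v \<longleftrightarrow>
     (\<forall>w\<in>{u, v}.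
        (\<forall>z\<in>closed_half_space. w z > 0) \<and>
        continuous_on closed_half_space w \<and>
        locally_finite_energy a w \<and>
        C2_on half_space w \<and>
        (\<forall>z\<in>half_space. L_op a w z = 0)) \<and>
     (\<forall>x. has_weighted_normal_deriv a u x (u (x, 0) * (v (x, 0))\<^sup>2)) \<and>
     (\<forall>x. has_weighted_normal_deriv a v x (v (x, 0) * (u (x, 0))\<^sup>2))"

end

theory Submission
  imports Defs
begin

text \<open>
  Each of \<open>u\<close> and \<open>v\<close> grows polynomially for a reason that concerns one function at a time. Write
  \<open>w\<close> for either of them. It is positive, \<open>L\<^sub>a w = 0\<close> in the open half-space, and its weighted normal
  derivative on the boundary is positive, being \<open>u v\<^sup>2\<close> or \<open>v u\<^sup>2\<close>. The last sign says that \<open>w\<close> is a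
  subsolution up to the boundary, and positive solutions in a half-space cannot grow faster than
  polynomially there.

  In the interior this is Harnack's inequality. The equation is invariant under dilations, so there
  is one constant \<open>K\<close> with \<open>w p \<le> K * w q\<close> whenever the distance of \<open>p\<close> and \<open>q\<close> is at most a
  sixteenth of the height of \<open>p\<close> (\<open>harnack\<close>). Going up from \<open>(x, y)\<close> to height \<open>R\<close>, moving sideways
  to \<open>(0, R)\<close> and going down to \<open>(0, 1)\<close> takes a number of steps that is logarithmic in \<open>R / y\<close> and
  in \<open>R\<close>, and a bounded number of sideways steps if \<open>norm x \<le> 2 * R\<close>. So
  \<open>w (x, y) \<le> const * (R / y) ^ m * w (0, R)\<close> and \<open>w (0, R) \<le> const * R ^ m * w (0, 1)\<close>.

  Harnack's inequality itself comes from an almost mean value property. Integrals of \<open>w\<close> against the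
  square of the truncated paraboloid \<open>max 0 (r\<^sup>2 - (norm (z - p))\<^sup>2)\<close> satisfy a differential
  inequality in the radius \<open>r\<close>: two integrations by parts turn the derivative in \<open>r\<close> into a multiple
  of the same integral, up to a relative error of order \<open>1 / snd p\<close>. Hence the weighted averages at all
  radii below half the height of \<open>p\<close> are comparable with \<open>w p\<close>, and averages around neighbouring
  points are comparable because the paraboloids are.

  The interior bound degenerates like \<open>y ^ (- m)\<close> at the boundary, where the boundary condition has to
  be used (\<open>bound_up_to_boundary\<close>). Consider a point at which
  \<open>w (x, y) * (2 * R - norm x) ^ m\<close> is maximal. Around it \<open>w\<close> exceeds its value \<open>M\<close> there at most by
  a constant factor, on a cylinder whose width \<open>r\<close> is proportional to \<open>2 * R - norm x\<close>. If \<open>M\<close> were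
  far above the interior bound at height \<open>\<epsilon> * r\<close>, then \<open>w\<close> would be less than \<open>M / 2\<close> on the lid of a thin
  cylinder of that height. A quadratic barrier shows that this is impossible
  (\<open>thin_cylinder_comparison\<close>): \<open>w\<close> minus the barrier has its maximum neither in the interior, by the
  equation, nor on the bottom, where \<open>w\<close> increases in the inward direction.
\<close>

section \<open>Integration by parts with compact support\<close>

text \<open>
  Multiplying by a cutoff supported in \<open>K \<subseteq> U\<close> makes the values of \<open>h\<close> outside \<open>U\<close> irrelevant. This is
  how functions that are regular only in the open half-space enter integrals over the whole space.
\<close>

lemma continuous_on_mult_cutoff:
  fixes \<phi> h :: "'a::euclidean_space \<Rightarrow> real"
  assumes "open U" "compact K" "K \<subseteq> U" "continuous_on U h" "continuous_on UNIV \<phi>"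
    and supp: "\<And>z. z \<notin> K \<Longrightarrow> \<phi> z = 0"
  shows "continuous_on UNIV (\<lambda>z. \<phi> z * h z)"
proof -
  have "continuous_on U (\<lambda>z. \<phi> z * h z)"
    using assms(4,5) by (auto intro!: continuous_intros intro: continuous_on_subset)
  moreover have "continuous_on (- K) (\<lambda>z. \<phi> z * h z)"
    by (rule continuous_on_eq[of _ "\<lambda>_. 0"]) (auto simp: supp)
  moreover have "open (- K)" using assms(2) by (auto intro: compact_imp_closed)
  ultimately have "continuous_on (U \<union> - K) (\<lambda>z. \<phi> z * h z)"
    using \<open>open U\<close> by (intro continuous_on_open_Un) auto
  moreover have "U \<union> - K = UNIV" using assms(3) by auto
  ultimately show ?thesis by simp
qed

lemma integrable_compact_support:
  fixes g :: "'a::euclidean_space \<Rightarrow> real"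
  assumes "continuous_on UNIV g" "compact K" "\<And>z. z \<notin> K \<Longrightarrow> g z = 0"
  shows "g integrable_on UNIV"
proof -
  obtain c where c: "K \<subseteq> cbox (- c) c"
    using bounded_subset_cbox_symmetric[OF compact_imp_bounded[OF assms(2)]] by auto
  have "g integrable_on cbox (- c) c"
    by (rule integrable_continuous) (use assms(1) continuous_on_subset in blast)
  then show ?thesis
    by (rule integrable_on_superset) (use assms(3) c in auto)
qed

lemma integrable_mult_cutoff:
  fixes \<phi> h :: "'a::euclidean_space \<Rightarrow> real"
  assumes "open U" "compact K" "K \<subseteq> U" "continuous_on U h" "continuous_on UNIV \<phi>"
    and "\<And>z. z \<notin> K \<Longrightarrow> \<phi> z = 0"
  shows "(\<lambda>z. \<phi> z * h z) integrable_on UNIV"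
  by (rule integrable_compact_support[OF continuous_on_mult_cutoff[OF assms] assms(2)])
     (auto simp: assms(6))

text \<open>
  Translating \<open>g\<close> along \<open>b\<close> does not change its integral, and differentiating under the integral sign
  gives the integral of \<open>g'\<close>. The integral is taken over a box so large that the translates by
  at most one unit still have their support in it.
\<close>

lemma integral_directional_derivative_eq_0:
  fixes g g' :: "'a::euclidean_space \<Rightarrow> real"
  assumes K: "compact K"
    and der: "\<And>z. ((\<lambda>t. g (z + t *\<^sub>R b)) has_real_derivative g' z) (at 0)"
    and cont: "continuous_on UNIV g" "continuous_on UNIV g'"
    and supp: "\<And>z. z \<notin> K \<Longrightarrow> g z = 0" "\<And>z. z \<notin> K \<Longrightarrow> g' z = 0"
  shows "integral UNIV g' = 0"
proof -
  define U where "U = {-1<..<1::real}"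
  have "bounded ((\<lambda>(z, t). z + t *\<^sub>R b) ` (K \<times> {-1..1}))"
    by (intro compact_imp_bounded compact_continuous_image compact_Times K)
       (auto simp: case_prod_unfold intro!: continuous_intros)
  then obtain c where c: "(\<lambda>(z, t). z + t *\<^sub>R b) ` (K \<times> {-1..1}) \<subseteq> cbox (- c) c"
    using bounded_subset_cbox_symmetric by blast
  have shift: "z + t *\<^sub>R b \<notin> K" if "z \<notin> cbox (- c) c" "t \<in> U" for z t
  proof
    assume "z + t *\<^sub>R b \<in> K"
    then have "(z + t *\<^sub>R b) + (- t) *\<^sub>R b \<in> (\<lambda>(z, t). z + t *\<^sub>R b) ` (K \<times> {-1..1})"
      using that(2) by (intro image_eqI[of _ _ "(z + t *\<^sub>R b, - t)"]) (auto simp: U_def)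
    then show False using c that(1) by auto
  qed
  have cont2: "continuous_on A (\<lambda>(t, z). h (z + t *\<^sub>R b))"
    if "continuous_on UNIV h" for h :: "'a \<Rightarrow> real" and A
    unfolding case_prod_unfold
    by (rule continuous_on_compose2[OF that]) (auto intro!: continuous_intros)
  have cont1: "continuous_on A (\<lambda>z. g (z + t *\<^sub>R b))" for A t
    by (rule continuous_on_compose2[OF cont(1)]) (auto intro!: continuous_intros)
  define F where "F t = integral (cbox (- c) c) (\<lambda>z. g (z + t *\<^sub>R b))" for t
  have F: "F t = integral UNIV g" if "t \<in> U" for t
  proof -
    have "(g has_integral integral (cbox (- c + t *\<^sub>R b) (c + t *\<^sub>R b)) g) (cbox (- c + t *\<^sub>R b) (c + t *\<^sub>R b))"
      by (intro integrable_integral integrable_continuous) (use cont(1) continuous_on_subset in blast)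
    then have "(g has_integral integral (cbox (- c + t *\<^sub>R b) (c + t *\<^sub>R b)) g) UNIV"
    proof (rule has_integral_on_superset)
      fix z assume z: "z \<notin> cbox (- c + t *\<^sub>R b) (c + t *\<^sub>R b)"
      have "z - t *\<^sub>R b \<notin> cbox (- c) c"
        using z by (auto simp: mem_box inner_diff_left inner_add_left algebra_simps)
      from shift[OF this that] show "g z = 0" by (auto intro: supp)
    qed auto
    then show ?thesis
      unfolding F_def using integral_shift_cbox_plus[of "- c" c g "t *\<^sub>R b"]
      by (simp add: integral_unique o_def add.commute)
  qed
  have "((\<lambda>t. integral (cbox (- c) c) (\<lambda>z. g (z + t *\<^sub>R b)))
      has_field_derivative integral (cbox (- c) c) (\<lambda>z. g' (z + 0 *\<^sub>R b))) (at 0 within U)"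
  proof (rule leibniz_rule_field_derivative)
    fix t z
    have "((\<lambda>s. g ((z + t *\<^sub>R b) + (s - t) *\<^sub>R b)) has_real_derivative g' (z + t *\<^sub>R b)) (at t)"
      using DERIV_shift[of "\<lambda>s. g ((z + t *\<^sub>R b) + (s - t) *\<^sub>R b)" "g' (z + t *\<^sub>R b)" 0 t]
        der[of "z + t *\<^sub>R b"] by simp
    then show "((\<lambda>t. g (z + t *\<^sub>R b)) has_field_derivative g' (z + t *\<^sub>R b)) (at t within U)"
      by (auto simp: algebra_simps intro: has_field_derivative_at_within)
  qed (auto simp: U_def intro!: integrable_continuous cont1 cont2 cont)
  then have "(F has_field_derivative integral (cbox (- c) c) g') (at 0)"
    unfolding F_def by (subst (asm) at_within_open) (auto simp: U_def)
  then have "((\<lambda>_. integral UNIV g) has_field_derivative integral (cbox (- c) c) g') (at 0)"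
    by (rule DERIV_cong_ev[THEN iffD1, rotated -1])
       (auto simp: F U_def intro!: eventually_nhds_in_open[of U, THEN eventually_mono])
  then have "integral (cbox (- c) c) g' = 0"
    using DERIV_const DERIV_unique by blast
  moreover have "integral UNIV g' = integral (cbox (- c) c) g'"
  proof (rule integral_unique, rule has_integral_on_superset)
    show "(g' has_integral integral (cbox (- c) c) g') (cbox (- c) c)"
      by (intro integrable_integral integrable_continuous) (use cont(2) continuous_on_subset in blast)
    fix z assume "z \<notin> cbox (- c) c"
    then show "g' z = 0" using shift[of z 0] by (auto simp: U_def intro: supp)
  qed auto
  ultimately show ?thesis by simp
qed

lemma integration_by_parts_compact_support:
  fixes f f' \<phi> \<phi>' :: "'a::euclidean_space \<Rightarrow> real"
  assumes U: "open U" and K: "compact K" "K \<subseteq> U"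
    and f: "\<And>z. z \<in> U \<Longrightarrow> ((\<lambda>t. f (z + t *\<^sub>R b)) has_real_derivative f' z) (at 0)"
      "continuous_on U f" "continuous_on U f'"
    and \<phi>: "\<And>z. ((\<lambda>t. \<phi> (z + t *\<^sub>R b)) has_real_derivative \<phi>' z) (at 0)"
      "continuous_on UNIV \<phi>" "continuous_on UNIV \<phi>'"
    and supp: "\<And>z. z \<notin> K \<Longrightarrow> \<phi> z = 0" "\<And>z. z \<notin> K \<Longrightarrow> \<phi>' z = 0"
  shows "integral UNIV (\<lambda>z. \<phi> z * f' z + \<phi>' z * f z) = 0"
proof (rule integral_directional_derivative_eq_0[OF K(1)])
  show "continuous_on UNIV (\<lambda>z. \<phi> z * f z)"
    by (rule continuous_on_mult_cutoff[OF U K f(2) \<phi>(2) supp(1)])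
  show "continuous_on UNIV (\<lambda>z. \<phi> z * f' z + \<phi>' z * f z)"
    by (intro continuous_on_add continuous_on_mult_cutoff[OF U K] f \<phi> supp)
  fix z
  show "((\<lambda>t. \<phi> (z + t *\<^sub>R b) * f (z + t *\<^sub>R b)) has_real_derivative \<phi> z * f' z + \<phi>' z * f z) (at 0)"
  proof (cases "z \<in> U")
    case True
    show ?thesis using DERIV_mult[OF \<phi>(1) f(1)[OF True]] by (simp add: algebra_simps)
  next
    case False
    then have z: "z \<in> - K" using K by auto
    \<comment> \<open>Outside \<open>K\<close> the product vanishes near \<open>z\<close>, whatever \<open>f\<close> does there.\<close>
    have "open ((\<lambda>t. z + t *\<^sub>R b) -` (- K))"
      using K by (intro open_vimage) (auto intro!: continuous_intros compact_imp_closed)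
    then have "\<forall>\<^sub>F t in nhds 0. z + t *\<^sub>R b \<in> - K"
      using eventually_nhds_in_open[of "(\<lambda>t. z + t *\<^sub>R b) -` (- K)" 0] z by simp
    then have "((\<lambda>t. \<phi> (z + t *\<^sub>R b) * f (z + t *\<^sub>R b)) has_real_derivative 0) (at 0) \<longleftrightarrow>
       ((\<lambda>t. 0) has_real_derivative 0) (at (0::real))"
      by (intro DERIV_cong_ev) (auto elim!: eventually_mono simp: supp)
    then show ?thesis using z supp by auto
  qed
qed (auto simp: supp)

section \<open>The equation in nondivergence form\<close>

lemma open_half_space: "open (half_space :: ((real ^ 'n) \<times> real) set)"
  unfolding half_space_def by (intro open_Collect_less continuous_intros)

text \<open>
  The derivatives are returned in coordinates: a gradient \<open>G\<close> and the derivative \<open>H\<close> of the gradient, so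
  that \<open>H z b \<bullet> b\<close> is the second derivative in the direction \<open>b\<close>.
\<close>

lemma C2_on_gradientE:
  fixes f :: "'a::euclidean_space \<Rightarrow> real"
  assumes "C2_on S f"
  obtains G :: "'a \<Rightarrow> 'a" and H :: "'a \<Rightarrow> 'a \<Rightarrow> 'a"
  where "\<And>z. z \<in> S \<Longrightarrow> (f has_derivative (\<lambda>h. G z \<bullet> h)) (at z)"
    and "\<And>z. z \<in> S \<Longrightarrow> (G has_derivative H z) (at z)"
    and "\<And>b. continuous_on S (\<lambda>z. H z b)"
proof -
  obtain f' f'' where f':
      "\<And>z. z \<in> S \<Longrightarrow> (f has_derivative blinfun_apply (f' z)) (at z)"
    and f'': "\<And>z. z \<in> S \<Longrightarrow> (f' has_derivative blinfun_apply (f'' z)) (at z)"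
    and cont: "continuous_on S f''"
    using assms unfolding C2_on_def by blast
  define G where "G z = (\<Sum>b\<in>Basis. blinfun_apply (f' z) b *\<^sub>R b)" for z
  define H where "H z h = (\<Sum>b\<in>Basis. blinfun_apply (blinfun_apply (f'' z) h) b *\<^sub>R b)" for z h
  have G: "G z \<bullet> h = blinfun_apply (f' z) h" for z h
  proof -
    have "blinfun_apply (f' z) h = blinfun_apply (f' z) (\<Sum>b\<in>Basis. (h \<bullet> b) *\<^sub>R b)"
      by (simp add: euclidean_representation)
    also have "\<dots> = (\<Sum>b\<in>Basis. (h \<bullet> b) * blinfun_apply (f' z) b)"
      by (simp add: blinfun.sum_right blinfun.scaleR_right)
    finally show ?thesis
      by (simp add: G_def inner_sum_left inner_commute[of h] mult.commute)
  qed
  show ?thesis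
  proof (rule that)
    show "(f has_derivative (\<lambda>h. G z \<bullet> h)) (at z)" if "z \<in> S" for z
      using f'[OF that] by (simp add: G)
    show "(G has_derivative H z) (at z)" if "z \<in> S" for z
      unfolding G_def[abs_def] H_def[abs_def]
      by (rule derivative_eq_intros f''[OF that] refl | simp add: blinfun.zero_right)+
    show "continuous_on S (\<lambda>z. H z b)" for b
      unfolding H_def by (intro continuous_intros cont)
  qed
qed

lemma gradient_eqI:
  assumes "(f has_derivative (\<lambda>h. g \<bullet> h)) (at z)"
  shows "gradient f z = g"
  unfolding gradient_def
proof (rule the_equality)
  show "GDERIV f z :> g" using assms by (simp add: gderiv_def inner_commute)
  fix g' assume "GDERIV f z :> g'"
  then have "(\<lambda>h. g \<bullet> h) = (\<lambda>h. h \<bullet> g')"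
    unfolding gderiv_def using assms has_derivative_unique by blast
  then have "\<And>h. h \<bullet> g' = h \<bullet> g" by (metis inner_commute)
  then show "g' = g" by (metis vector_eq_ldot)
qed

lemma L_op_nondivergence_form:
  fixes w :: "(real ^ 'n) \<times> real \<Rightarrow> real"
  assumes z: "z \<in> half_space"
    and w: "\<And>z. z \<in> half_space \<Longrightarrow> (w has_derivative (\<lambda>h. G z \<bullet> h)) (at z)"
    and G: "(G has_derivative H) (at z)"
  shows "L_op a w z = snd z powr a * ((\<Sum>b\<in>Basis. H b \<bullet> b) + a / snd z * (G z \<bullet> (0, 1)))"
proof -
  have y: "snd z > 0" using z by (simp add: half_space_def)
  have powr: "((\<lambda>z::(real ^ 'n) \<times> real. snd z powr a) has_derivative (\<lambda>h. a * snd z powr (a - 1) * snd h)) (at z)"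
    using y by (auto intro!: derivative_eq_intros simp: powr_diff field_simps)
  have "((\<lambda>z. (snd z powr a) *\<^sub>R G z) has_derivative
      (\<lambda>h. (snd z powr a) *\<^sub>R H h + (a * snd z powr (a - 1) * snd h) *\<^sub>R G z)) (at z)"
    by (rule has_derivative_scaleR[OF powr G])
  then have "((\<lambda>z. (snd z powr a) *\<^sub>R gradient w z) has_derivative
      (\<lambda>h. (snd z powr a) *\<^sub>R H h + (a * snd z powr (a - 1) * snd h) *\<^sub>R G z)) (at z)"
    by (rule has_derivative_transform_within_open[OF _ open_half_space z])
       (simp add: gradient_eqI[OF w])
  from frechet_derivative_at[OF this]
  have "L_op a w z = (\<Sum>b\<in>Basis. ((snd z powr a) *\<^sub>R H b + (a * snd z powr (a - 1) * snd b) *\<^sub>R G z) \<bullet> b)"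
    unfolding L_op_def divergence_def by metis
  also have "\<dots> = snd z powr a * (\<Sum>b\<in>Basis. H b \<bullet> b) + a * snd z powr (a - 1) * (\<Sum>b\<in>Basis. snd b * (G z \<bullet> b))"
    by (simp add: inner_add_left sum.distrib sum_distrib_left mult.assoc)
  also have "(\<Sum>b\<in>Basis. snd b * (G z \<bullet> b)) = G z \<bullet> (0, 1)"
    by (subst euclidean_inner[of "G z"]) (auto simp: inner_prod_def mult.commute intro!: sum.cong)
  finally show ?thesis using y by (simp add: powr_diff field_simps)
qed

text \<open>
  The gradient and its derivative are parameters, so that the estimates below can speak of them
  without choosing derivatives. The equation is divided by the weight \<open>snd z powr a\<close>, so
  that its second-order part is the Laplacian, as the integrations by parts require.
\<close>

locale La_solution =
  fixes a :: real and w :: "(real ^ 'n) \<times> real \<Rightarrow> real"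
    and G :: "(real ^ 'n) \<times> real \<Rightarrow> (real ^ 'n) \<times> real"
    and H :: "(real ^ 'n) \<times> real \<Rightarrow> (real ^ 'n) \<times> real \<Rightarrow> (real ^ 'n) \<times> real"
  assumes a: "-1 < a"
    and pos: "\<And>z. z \<in> half_space \<Longrightarrow> w z > 0"
    and w_deriv: "\<And>z. z \<in> half_space \<Longrightarrow> (w has_derivative (\<lambda>h. G z \<bullet> h)) (at z)"
    and G_deriv: "\<And>z. z \<in> half_space \<Longrightarrow> (G has_derivative H z) (at z)"
    and H_cont: "\<And>b. continuous_on half_space (\<lambda>z. H z b)"
    and pde: "\<And>z. z \<in> half_space \<Longrightarrow> (\<Sum>b\<in>Basis. H z b \<bullet> b) + a / snd z * (G z \<bullet> (0, 1)) = 0"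
begin

lemma w_cont: "continuous_on half_space w"
  by (meson w_deriv has_derivative_continuous continuous_at_imp_continuous_on)

lemma G_cont: "continuous_on half_space G"
  by (meson G_deriv has_derivative_continuous continuous_at_imp_continuous_on)

lemma w_line_deriv:
  assumes "z \<in> half_space"
  shows "((\<lambda>t. w (z + t *\<^sub>R b)) has_real_derivative G z \<bullet> b) (at 0)"
proof -
  have "((\<lambda>t. w (z + t *\<^sub>R b)) has_derivative (\<lambda>t. G z \<bullet> (t *\<^sub>R b))) (at 0)"
    by (rule has_derivative_compose[of "\<lambda>t. z + t *\<^sub>R b" "\<lambda>t. t *\<^sub>R b"])
       (auto intro!: derivative_eq_intros simp: w_deriv assms)
  then show ?thesis
    by (simp add: has_field_derivative_def mult.commute[of _ "G z \<bullet> b"])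
qed

lemma G_line_deriv:
  assumes "z \<in> half_space"
  shows "((\<lambda>t. G (z + t *\<^sub>R b) \<bullet> c) has_real_derivative H z b \<bullet> c) (at 0)"
proof -
  have lin: "H z (t *\<^sub>R b) = t *\<^sub>R H z b" for t
    using has_derivative_linear[OF G_deriv[OF assms]] by (simp add: linear_scale)
  have "((\<lambda>t. G (z + t *\<^sub>R b)) has_derivative (\<lambda>t. H z (t *\<^sub>R b))) (at 0)"
    by (rule has_derivative_compose[of "\<lambda>t. z + t *\<^sub>R b" "\<lambda>t. t *\<^sub>R b"])
       (auto intro!: derivative_eq_intros simp: G_deriv assms)
  then have "((\<lambda>t. G (z + t *\<^sub>R b) \<bullet> c) has_derivative (\<lambda>t. H z (t *\<^sub>R b) \<bullet> c)) (at 0)"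
    by (rule has_derivative_inner_left)
  then show ?thesis
    by (simp add: has_field_derivative_def lin mult.commute[of _ "H z b \<bullet> c"])
qed

end

lemma is_solution_La_solution:
  fixes u v :: "(real ^ 'n) \<times> real \<Rightarrow> real"
  assumes "-1 < a" "is_solution a u v" "w \<in> {u, v}"
  obtains G H where "La_solution a w G H"
proof -
  have w: "\<And>z. z \<in> closed_half_space \<Longrightarrow> w z > 0" "C2_on half_space w"
      "\<And>z. z \<in> half_space \<Longrightarrow> L_op a w z = 0"
    using assms(2,3) unfolding is_solution_def by blast+
  obtain G H where GH:
    "\<And>z. z \<in> half_space \<Longrightarrow> (w has_derivative (\<lambda>h. G z \<bullet> h)) (at z)"
    "\<And>z. z \<in> half_space \<Longrightarrow> (G has_derivative H z) (at z)"
    "\<And>b. continuous_on half_space (\<lambda>z. H z b)"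
    using C2_on_gradientE[OF w(2)] by metis
  have "La_solution a w G H"
  proof
    fix z :: "(real ^ 'n) \<times> real" assume z: "z \<in> half_space"
    then show "w z > 0" by (intro w(1)) (simp add: half_space_def closed_half_space_def)
    show "(\<Sum>b\<in>Basis. H z b \<bullet> b) + a / snd z * (G z \<bullet> (0, 1)) = 0"
      using L_op_nondivergence_form[OF z GH(1) GH(2)[OF z], of a] w(3)[OF z] z
      by (simp add: half_space_def)
  qed (use assms GH in auto)
  then show ?thesis by (rule that)
qed

section \<open>Integrals against truncated paraboloids\<close>

text \<open>
  From the second power on, the positive part is continuously differentiable also at the kink.
\<close>

lemma has_real_derivative_pos_part_power:
  "((\<lambda>x::real. max 0 x ^ (m + 2)) has_real_derivative real (m + 2) * max 0 x ^ (m + 1)) (at x)"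
proof (cases x "0::real" rule: linorder_cases)
  case less
  have "\<forall>\<^sub>F t in nhds x. t \<in> {..<0}"
    using less by (intro eventually_nhds_in_open) auto
  then have "\<forall>\<^sub>F t in nhds x. max 0 t ^ (m + 2) = 0"
    by eventually_elim (simp add: max_def)
  then have "((\<lambda>x::real. max 0 x ^ (m + 2)) has_real_derivative 0) (at x) \<longleftrightarrow> ((\<lambda>x::real. 0) has_real_derivative 0) (at x)"
    by (rule DERIV_cong_ev[OF refl _ refl])
  then show ?thesis using less by (simp add: max_def)
next
  case greater
  have "\<forall>\<^sub>F t in nhds x. t \<in> {0<..}"
    using greater by (intro eventually_nhds_in_open) auto
  then have ev: "\<forall>\<^sub>F t in nhds x. max 0 t ^ (m + 2) = t ^ (m + 2)"
    by eventually_elim (simp add: max_def)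
  have "((\<lambda>x::real. x ^ (m + 2)) has_real_derivative real (m + 2) * x ^ (m + 1)) (at x)"
    by (rule derivative_eq_intros refl | simp)+
  then show ?thesis
    using DERIV_cong_ev[OF refl ev refl] greater by (simp add: max_def)
next
  case equal
  have "((\<lambda>h::real. max 0 h ^ (m + 2) / h) \<longlongrightarrow> 0) (at 0)"
  proof (rule Lim_null_comparison)
    show "\<forall>\<^sub>F h in at 0. norm (max 0 h ^ (m + 2) / h) \<le> \<bar>h\<bar> ^ (m + 1)"
    proof (rule always_eventually, rule allI)
      fix h :: real
      have "max 0 h ^ (m + 2) / h = (if h > 0 then h ^ (m + 1) else 0)"
        by (auto simp: max_def)
      then show "norm (max 0 h ^ (m + 2) / h) \<le> \<bar>h\<bar> ^ (m + 1)"
        by (cases "h > 0") (simp_all only: if_True if_False real_norm_def power_abs abs_0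
          order_refl zero_le_power abs_ge_zero)
    qed
    have "((\<lambda>h::real. \<bar>h\<bar> ^ (m + 1)) \<longlongrightarrow> \<bar>0\<bar> ^ (m + 1)) (at 0)"
      by (intro tendsto_intros)
    then show "((\<lambda>h::real. \<bar>h\<bar> ^ (m + 1)) \<longlongrightarrow> 0) (at 0)" by simp
  qed
  then show ?thesis using equal by (simp add: DERIV_def)
qed

text \<open>
  The truncated paraboloid is adapted to integration by parts around \<open>p\<close>: the gradient of
  \<open>bump p r z ^ (k + 1)\<close> is \<open>- 2 * (k + 1) * bump p r z ^ k\<close> times \<open>z - p\<close>, and on the support
  \<open>(norm (z - p))\<^sup>2\<close> can be traded for \<open>r\<^sup>2\<close> minus the bump itself. Powers of it thus reproduce each
  other, and squares and cubes are continuously differentiable.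
\<close>

definition bump :: "'a::real_inner \<Rightarrow> real \<Rightarrow> 'a \<Rightarrow> real" where
  "bump p r z = max 0 (r\<^sup>2 - (norm (z - p))\<^sup>2)"

lemma bump_nonneg: "bump p r z \<ge> 0"
  by (simp add: bump_def)

lemma bump_eq_0: "r \<ge> 0 \<Longrightarrow> z \<notin> cball p r \<Longrightarrow> bump p r z = 0"
  by (auto simp: bump_def dist_norm norm_minus_commute intro!: max_absorb1 power_mono)

lemma bump_le: "bump p r z \<le> r\<^sup>2"
  by (simp add: bump_def)

lemma bump_mult_norm: "bump p r z * (norm (z - p))\<^sup>2 = bump p r z * (r\<^sup>2 - bump p r z)"
  by (auto simp: bump_def max_def)

lemma continuous_on_bump: "continuous_on A (bump p r)"
  unfolding bump_def by (intro continuous_intros)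

lemma bump_line_deriv:
  "((\<lambda>t. bump p r (z + t *\<^sub>R b) ^ (m + 2)) has_real_derivative
     real (m + 2) * bump p r z ^ (m + 1) * (- 2 * ((z - p) \<bullet> b))) (at 0)"
proof -
  have "((\<lambda>t. r\<^sup>2 - (norm (z + t *\<^sub>R b - p))\<^sup>2) has_real_derivative - 2 * ((z - p) \<bullet> b)) (at 0)"
    unfolding power2_norm_eq_inner
    by (auto intro!: derivative_eq_intros simp: has_field_derivative_def inner_commute algebra_simps)
  from DERIV_chain2[OF has_real_derivative_pos_part_power this] show ?thesis
    by (simp add: bump_def)
qed

lemma bump_radius_deriv:
  "((\<lambda>r. (bump p r z)\<^sup>2) has_real_derivative 4 * r * bump p r z) (at r)"
proof -
  have "((\<lambda>r. r\<^sup>2 - (norm (z - p))\<^sup>2) has_real_derivative 2 * r) (at r)"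
    by (auto intro!: derivative_eq_intros)
  from DERIV_chain2[OF has_real_derivative_pos_part_power[of 0] this] show ?thesis
    by (simp add: bump_def numeral_2_eq_2 mult_ac)
qed

lemma cball_subset_half_space:
  "r < snd p \<Longrightarrow> cball p r \<subseteq> (half_space :: ((real ^ 'n) \<times> real) set)"
proof
  fix z :: "(real ^ 'n) \<times> real" assume "r < snd p" "z \<in> cball p r"
  moreover have "\<bar>snd p - snd z\<bar> \<le> dist p z"
    by (metis dist_real_def dist_snd_le)
  ultimately show "z \<in> half_space" by (auto simp: half_space_def)
qed

text \<open>
  Dividing by the value for \<open>w = 1\<close> gives an average of \<open>w\<close> over the ball of radius \<open>r\<close>. The
  integral is left unnormalised, because the differential inequality in \<open>r\<close> is linear in it.
\<close>

definition weighted_mass :: "('a::euclidean_space \<Rightarrow> real) \<Rightarrow> 'a \<Rightarrow> real \<Rightarrow> real" where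
  "weighted_mass w p r = integral UNIV (\<lambda>z. (bump p r z)\<^sup>2 * w z)"

context La_solution
begin

lemma bump_integrable:
  assumes "0 \<le> r" "r < snd p" "continuous_on half_space h" "k > 0"
  shows "(\<lambda>z. (bump p r z) ^ k * h z) integrable_on UNIV"
  by (rule integrable_mult_cutoff[OF open_half_space compact_cball cball_subset_half_space[OF assms(2)]])
     (use assms in \<open>auto intro!: continuous_intros continuous_on_bump simp: bump_eq_0\<close>)

lemma bump_parts:
  assumes r: "0 \<le> r" "r < snd p"
    and f: "\<And>z. z \<in> half_space \<Longrightarrow> ((\<lambda>t. f (z + t *\<^sub>R b)) has_real_derivative f' z) (at 0)"
      "continuous_on half_space f" "continuous_on half_space f'"
  shows "integral UNIV (\<lambda>z. bump p r z ^ (m + 2) * f' z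
      - real (m + 2) * bump p r z ^ (m + 1) * (2 * ((z - p) \<bullet> b)) * f z) = 0"
proof -
  have "integral UNIV (\<lambda>z. bump p r z ^ (m + 2) * f' z
      + (real (m + 2) * bump p r z ^ (m + 1) * (- 2 * ((z - p) \<bullet> b))) * f z) = 0"
    by (rule integration_by_parts_compact_support[OF open_half_space compact_cball
          cball_subset_half_space[OF r(2)] f bump_line_deriv])
       (auto intro!: continuous_intros continuous_on_bump simp: bump_eq_0 r)
  then show ?thesis by (simp add: algebra_simps)
qed

text \<open>
  The integral of the divergence of \<open>(bump p r z)\<^sup>2 * w z\<close> times \<open>z - p\<close> vanishes. The left-hand side is
  \<open>r\<close> times the derivative of the weighted mass in \<open>r\<close>; the exponent of its growth is the dimension
  plus four, since the square of the bump scales like \<open>r ^ 4\<close>.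
\<close>

lemma radial_identity:
  assumes r: "0 \<le> r" "r < snd p"
  shows "integral UNIV (\<lambda>z. 4 * r\<^sup>2 * (bump p r z * w z)) =
    (DIM((real ^ 'n) \<times> real) + 4) * weighted_mass w p r
    + integral UNIV (\<lambda>z. (bump p r z)\<^sup>2 * (G z \<bullet> (z - p)))"
proof -
  let ?B = "Basis :: ((real ^ 'n) \<times> real) set"
  define F where "F b z = (bump p r z)\<^sup>2 * (w z * (b \<bullet> b) + (G z \<bullet> b) * ((z - p) \<bullet> b))
      - 4 * bump p r z * ((z - p) \<bullet> b) * (w z * ((z - p) \<bullet> b))" for b z
  have F0: "integral UNIV (F b) = 0" for b
  proof -
    have "((\<lambda>t. w (z + t *\<^sub>R b) * ((z + t *\<^sub>R b - p) \<bullet> b)) has_real_derivative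
            w z * (b \<bullet> b) + (G z \<bullet> b) * ((z - p) \<bullet> b)) (at 0)" if "z \<in> half_space" for z
    proof -
      have "((\<lambda>t. (z + t *\<^sub>R b - p) \<bullet> b) has_real_derivative b \<bullet> b) (at 0)"
        by (auto intro!: derivative_eq_intros simp: has_field_derivative_def)
      from DERIV_mult[OF w_line_deriv[OF that] this] show ?thesis
        by (simp add: algebra_simps)
    qed
    from bump_parts[OF r this, where m = 0]
    have "integral UNIV (\<lambda>z. (bump p r z)\<^sup>2 * (w z * (b \<bullet> b) + (G z \<bullet> b) * ((z - p) \<bullet> b))
      - 2 * bump p r z * (2 * ((z - p) \<bullet> b)) * (w z * ((z - p) \<bullet> b))) = 0"
      by (simp add: continuous_intros w_cont G_cont numeral_2_eq_2)
    then show ?thesis unfolding F_def by (simp add: mult_ac)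
  qed
  have cont: "continuous_on half_space (\<lambda>z. w z * (b \<bullet> b) + (G z \<bullet> b) * ((z - p) \<bullet> b))"
    "continuous_on half_space (\<lambda>z. ((z - p) \<bullet> b) * (w z * ((z - p) \<bullet> b)))"
    "continuous_on half_space (\<lambda>z. G z \<bullet> (z - p))" for b
    by (intro continuous_intros w_cont G_cont)+
  have Fint: "F b integrable_on UNIV" for b
  proof -
    have "(\<lambda>z. bump p r z ^ 2 * (w z * (b \<bullet> b) + (G z \<bullet> b) * ((z - p) \<bullet> b))
        - 4 * (bump p r z ^ 1 * (((z - p) \<bullet> b) * (w z * ((z - p) \<bullet> b))))) integrable_on UNIV"
      by (intro integrable_diff integrable_on_mult_right bump_integrable r cont) auto
    then show ?thesis unfolding F_def[abs_def] by (simp add: mult_ac)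
  qed
  have sumF: "(\<Sum>b\<in>?B. F b z) = ((DIM((real ^ 'n) \<times> real) + 4) * ((bump p r z)\<^sup>2 * w z)
      + (bump p r z)\<^sup>2 * (G z \<bullet> (z - p))) - 4 * r\<^sup>2 * (bump p r z * w z)" for z
  proof -
    have "(\<Sum>b\<in>?B. F b z) = (bump p r z)\<^sup>2 * w z * (\<Sum>b\<in>?B. b \<bullet> b)
       + (bump p r z)\<^sup>2 * (\<Sum>b\<in>?B. (G z \<bullet> b) * ((z - p) \<bullet> b))
       - 4 * bump p r z * w z * (\<Sum>b\<in>?B. ((z - p) \<bullet> b) * ((z - p) \<bullet> b))"
      unfolding F_def sum_subtractf sum_distrib_left sum.distrib[symmetric]
      by (intro arg_cong2[where f = minus] sum.cong) (auto simp: algebra_simps)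
    also have "(\<Sum>b\<in>?B. (G z \<bullet> b) * ((z - p) \<bullet> b)) = G z \<bullet> (z - p)"
      by (rule euclidean_inner[symmetric])
    also have "(\<Sum>b\<in>?B. ((z - p) \<bullet> b) * ((z - p) \<bullet> b)) = (norm (z - p))\<^sup>2"
      unfolding power2_norm_eq_inner by (rule euclidean_inner[symmetric])
    also have "(\<Sum>b\<in>?B. b \<bullet> b) = real (DIM((real ^ 'n) \<times> real))"
      by (simp add: inner_Basis del: DIM_prod)
    also have "4 * bump p r z * w z * (norm (z - p))\<^sup>2 = 4 * w z * (bump p r z * (norm (z - p))\<^sup>2)"
      by simp
    finally show ?thesis
      unfolding bump_mult_norm by (simp add: algebra_simps power2_eq_square del: DIM_prod)
  qed
  have "0 = (\<Sum>b\<in>?B. integral UNIV (F b))" by (simp add: F0)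
  also have "\<dots> = integral UNIV (\<lambda>z. \<Sum>b\<in>?B. F b z)"
    by (rule integral_sum[symmetric]) (auto simp: Fint)
  also have "\<dots> = (DIM((real ^ 'n) \<times> real) + 4) * weighted_mass w p r
      + integral UNIV (\<lambda>z. (bump p r z)\<^sup>2 * (G z \<bullet> (z - p)))
      - integral UNIV (\<lambda>z. 4 * r\<^sup>2 * (bump p r z * w z))"
  proof -
    have i: "(\<lambda>z. (bump p r z)\<^sup>2 * w z) integrable_on UNIV"
       "(\<lambda>z. (bump p r z)\<^sup>2 * (G z \<bullet> (z - p))) integrable_on UNIV"
       "(\<lambda>z. bump p r z * w z) integrable_on UNIV"
      using bump_integrable[OF r w_cont, of 2] bump_integrable[OF r w_cont, of 1]
        bump_integrable[OF r cont(3), of 2] by auto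
    show ?thesis unfolding sumF weighted_mass_def
      by (subst integral_diff integral_add integral_mult_right | intro integrable_add integrable_on_mult_right i refl)+
  qed
  finally show ?thesis by simp
qed

text \<open>
  Here the vector field is \<open>(bump p r z) ^ 3\<close> times \<open>G z + (a * w z / snd z) *\<^sub>R (0, 1)\<close>. By the
  equation its divergence contains no second derivatives of \<open>w\<close>, and the only first derivatives left are
  the ones on the left-hand side, so that the radial derivative of \<open>w\<close> is controlled by \<open>w\<close>.
\<close>

lemma radial_gradient_identity:
  assumes r: "0 \<le> r" "r < snd p"
  shows "6 * integral UNIV (\<lambda>z. (bump p r z)\<^sup>2 * (G z \<bullet> (z - p))) =
    - a * integral UNIV (\<lambda>z. (bump p r z)\<^sup>2 * (w z * (bump p r z / (snd z)\<^sup>2 + 6 * snd (z - p) / snd z)))"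
proof -
  let ?B = "Basis :: ((real ^ 'n) \<times> real) set"
  let ?g = "\<lambda>z. w z / snd z"
  let ?g' = "\<lambda>z. (G z \<bullet> (0, 1)) / snd z - w z / (snd z)\<^sup>2"
  let ?R = "\<lambda>z. w z * (bump p r z / (snd z)\<^sup>2 + 6 * snd (z - p) / snd z)"
  define F where "F b z = (bump p r z) ^ 3 * (H z b \<bullet> b) - 6 * ((bump p r z)\<^sup>2 * (((z - p) \<bullet> b) * (G z \<bullet> b)))" for b z
  define E where "E z = (bump p r z) ^ 3 * ?g' z - 6 * ((bump p r z)\<^sup>2 * (snd (z - p) * ?g z))" for z
  have ypos: "snd z > 0" if "z \<in> half_space" for z :: "(real ^ 'n) \<times> real"
    using that by (simp add: half_space_def)
  have cont: "continuous_on half_space (\<lambda>z. H z b \<bullet> b)"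
    "continuous_on half_space (\<lambda>z. ((z - p) \<bullet> b) * (G z \<bullet> b))"
    "continuous_on half_space ?g'" "continuous_on half_space ?g"
    "continuous_on half_space (\<lambda>z. snd (z - p) * ?g z)"
    "continuous_on half_space (\<lambda>z. G z \<bullet> (z - p))" "continuous_on half_space ?R" for b
    by (intro continuous_intros w_cont G_cont H_cont continuous_on_bump ballI;
        use ypos in force)+
  have F0: "integral UNIV (F b) = 0" for b
    using bump_parts[OF r G_line_deriv[of _ b b], where m = 1]
    by (simp add: F_def[abs_def] continuous_intros G_cont H_cont numeral_eq_Suc mult_ac)
  have E0: "integral UNIV E = 0"
  proof -
    have "((\<lambda>t. ?g (z + t *\<^sub>R (0, 1))) has_real_derivative ?g' z) (at 0)" if "z \<in> half_space" for z
      using ypos[OF that]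
      by (auto intro!: derivative_eq_intros w_line_deriv[OF that, of "(0,1)", simplified] simp: field_simps power2_eq_square zero_prod_def[symmetric])
    from bump_parts[OF r this cont(4,3), where m = 1]
    have "integral UNIV (\<lambda>z. bump p r z ^ (1 + 2) * ?g' z
      - real (1 + 2) * bump p r z ^ (1 + 1) * (2 * ((z - p) \<bullet> (0, 1))) * ?g z) = 0" .
    also have "(\<lambda>z. bump p r z ^ (1 + 2) * ?g' z
      - real (1 + 2) * bump p r z ^ (1 + 1) * (2 * ((z - p) \<bullet> (0, 1))) * ?g z) = E"
      unfolding E_def by (rule ext) (simp add: inner_prod_def numeral_eq_Suc)
    finally show ?thesis .
  qed
  have Fint: "F b integrable_on UNIV" for b
    unfolding F_def[abs_def]
    by (intro integrable_diff integrable_on_mult_right bump_integrable r cont) auto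
  have Eint: "E integrable_on UNIV"
    unfolding E_def[abs_def]
    by (intro integrable_diff integrable_on_mult_right bump_integrable r cont) auto
  have sumF: "(\<Sum>b\<in>?B. F b z) + a * E z =
      - 6 * ((bump p r z)\<^sup>2 * (G z \<bullet> (z - p))) - a * ((bump p r z)\<^sup>2 * ?R z)" for z
  proof (cases "z \<in> half_space")
    case False
    then have "bump p r z = 0"
      using cball_subset_half_space[OF r(2)] by (intro bump_eq_0 r) auto
    then show ?thesis by (simp add: F_def E_def)
  next
    case True
    have "(\<Sum>b\<in>?B. F b z) = bump p r z ^ 3 * (\<Sum>b\<in>?B. H z b \<bullet> b)
        - 6 * ((bump p r z)\<^sup>2 * (\<Sum>b\<in>?B. ((z - p) \<bullet> b) * (G z \<bullet> b)))"
      unfolding F_def sum_subtractf sum_distrib_left ..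
    also have "(\<Sum>b\<in>?B. ((z - p) \<bullet> b) * (G z \<bullet> b)) = G z \<bullet> (z - p)"
      by (subst inner_commute) (rule euclidean_inner[symmetric])
    also have "(\<Sum>b\<in>?B. H z b \<bullet> b) = - (a / snd z * (G z \<bullet> (0, 1)))"
      using pde[OF True] by simp
    finally show ?thesis
      unfolding E_def by (simp add: algebra_simps power2_eq_square power3_eq_cube)
  qed
  have "0 = (\<Sum>b\<in>?B. integral UNIV (F b)) + a * integral UNIV E" by (simp add: F0 E0)
  also have "\<dots> = integral UNIV (\<lambda>z. (\<Sum>b\<in>?B. F b z) + a * E z)"
    by (subst integral_add) (auto simp: integral_sum Fint intro!: integrable_sum integrable_on_mult_right Eint Fint)
  also have "\<dots> = - 6 * integral UNIV (\<lambda>z. (bump p r z)\<^sup>2 * (G z \<bullet> (z - p)))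
      - a * integral UNIV (\<lambda>z. (bump p r z)\<^sup>2 * ?R z)"
  proof -
    have i: "(\<lambda>z. (bump p r z)\<^sup>2 * ?R z) integrable_on UNIV"
       "(\<lambda>z. (bump p r z)\<^sup>2 * (G z \<bullet> (z - p))) integrable_on UNIV"
      using bump_integrable[OF r cont(6), of 2] bump_integrable[OF r cont(7), of 2] by auto
    show ?thesis unfolding sumF
      by (subst integral_diff integral_mult_right | intro integrable_on_mult_right i refl)+
  qed
  finally show ?thesis by simp
qed

text \<open>
  On a ball whose radius is at most half the height of its centre, the coefficient \<open>a / snd z\<close> of the
  first-order term is of the order of \<open>1 / snd p\<close>. The error is therefore small relative to the mass as
  soon as \<open>r\<close> is small relative to the height.
\<close>

lemma radial_gradient_bound:
  assumes r: "0 \<le> r" "2 * r \<le> snd p" "snd p > 0"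
  shows "\<bar>integral UNIV (\<lambda>z. (bump p r z)\<^sup>2 * (G z \<bullet> (z - p)))\<bar>
    \<le> 3 * \<bar>a\<bar> * (r / snd p) * weighted_mass w p r"
proof -
  have r': "r < snd p" using r by linarith
  let ?R = "\<lambda>z. w z * (bump p r z / (snd z)\<^sup>2 + 6 * snd (z - p) / snd z)"
  define Y where "Y = snd p"
  have Y: "Y > 0" "2 * r \<le> Y" using r by (auto simp: Y_def)
  have cont: "continuous_on half_space ?R"
    by (intro continuous_intros w_cont continuous_on_bump ballI) (auto simp: half_space_def)
  have i1: "(\<lambda>z. (bump p r z)\<^sup>2 * ?R z) integrable_on UNIV"
    using bump_integrable[OF r(1) r' cont, of 2] by simp
  have i2: "(\<lambda>z. 14 * r / Y * ((bump p r z)\<^sup>2 * w z)) integrable_on UNIV"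
    using bump_integrable[OF r(1) r' w_cont, of 2] by (intro integrable_on_mult_right) simp
  have bound: "norm ((bump p r z)\<^sup>2 * ?R z) \<le> 14 * r / Y * ((bump p r z)\<^sup>2 * w z)" for z
  proof (cases "z \<in> cball p r")
    case False
    then show ?thesis using bump_eq_0[OF r(1) False] by simp
  next
    case True
    have d: "\<bar>snd (z - p)\<bar> \<le> r"
      using True dist_snd_le[of p z] by (auto simp: dist_real_def abs_minus_commute)
    then have y: "snd z \<ge> Y / 2" using Y unfolding Y_def by simp
    have w: "w z \<ge> 0" using pos[of z] y Y by (simp add: half_space_def less_imp_le)
    have "bump p r z / (snd z)\<^sup>2 \<le> r\<^sup>2 / (Y / 2)\<^sup>2"
      using y Y by (intro frac_le bump_le power_mono) auto
    also have "\<dots> = 4 * (r / Y) * (r / Y)" by (simp add: power2_eq_square)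
    also have "\<dots> \<le> 4 * (r / Y) * (1 / 2)"
      using r Y by (intro mult_left_mono) (auto simp: field_simps)
    finally have 1: "bump p r z / (snd z)\<^sup>2 \<le> 2 * (r / Y)" by simp
    have "\<bar>snd (z - p) / snd z\<bar> \<le> r / (Y / 2)"
      unfolding abs_divide using d y Y by (intro frac_le) auto
    then have 2: "\<bar>snd (z - p) / snd z\<bar> \<le> 2 * (r / Y)" by (simp add: mult.commute)
    \<comment> \<open>\<open>14 = 2 + 6 * 2\<close>; after division by the factor 6 of the identity it is rounded up to 3.\<close>
    have "\<bar>bump p r z / (snd z)\<^sup>2 + 6 * snd (z - p) / snd z\<bar> \<le> 14 * (r / Y)"
    proof -
      have "0 \<le> bump p r z / (snd z)\<^sup>2" by (simp add: bump_nonneg)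
      with 1 2 show ?thesis
        unfolding times_divide_eq_right[of 6, symmetric] abs_le_iff by linarith
    qed
    then have "(bump p r z)\<^sup>2 * w z * \<bar>bump p r z / (snd z)\<^sup>2 + 6 * snd (z - p) / snd z\<bar>
        \<le> (bump p r z)\<^sup>2 * w z * (14 * (r / Y))"
      using w by (intro mult_left_mono) auto
    then show ?thesis using w by (simp add: abs_mult mult_ac)
  qed
  have "norm (integral UNIV (\<lambda>z. (bump p r z)\<^sup>2 * ?R z)) \<le> integral UNIV (\<lambda>z. 14 * r / Y * ((bump p r z)\<^sup>2 * w z))"
    by (rule integral_norm_bound_integral[OF i1 i2]) (use bound in auto)
  also have "\<dots> = 14 * r / Y * weighted_mass w p r"
    unfolding weighted_mass_def by (rule integral_mult_right)
  finally have I: "\<bar>integral UNIV (\<lambda>z. (bump p r z)\<^sup>2 * ?R z)\<bar> \<le> 14 * r / Y * weighted_mass w p r" by simp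
  then have "0 \<le> 14 * (r / Y * weighted_mass w p r)" by simp
  then have q: "0 \<le> 4 * \<bar>a\<bar> * (r / Y * weighted_mass w p r)"
    by (intro mult_nonneg_nonneg[of _ "r / Y * weighted_mass w p r"]) (simp, linarith)
  have "6 * \<bar>integral UNIV (\<lambda>z. (bump p r z)\<^sup>2 * (G z \<bullet> (z - p)))\<bar> =
      \<bar>a\<bar> * \<bar>integral UNIV (\<lambda>z. (bump p r z)\<^sup>2 * ?R z)\<bar>"
    using radial_gradient_identity[OF r(1) r'] by (simp flip: abs_mult)
  also have "\<dots> \<le> \<bar>a\<bar> * (14 * r / Y * weighted_mass w p r)"
    by (intro mult_left_mono I) auto
  also have "\<dots> \<le> \<bar>a\<bar> * (14 * r / Y * weighted_mass w p r) + 4 * \<bar>a\<bar> * (r / Y * weighted_mass w p r)"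
    using q by linarith
  also have "\<dots> = 6 * (3 * \<bar>a\<bar> * (r / Y) * weighted_mass w p r)" by simp
  finally show ?thesis by (simp add: Y_def)
qed

text \<open>
  Only the bump depends on the radius, so differentiation under the integral sign costs no regularity
  of \<open>w\<close>. The box around \<open>p\<close> with half side \<open>snd p / 2\<close> contains all the balls in question and still lies
  in the half-space.
\<close>

lemma weighted_mass_deriv:
  assumes r: "0 < r" "2 * r < snd p"
  obtains D where "(weighted_mass w p has_real_derivative D) (at r)"
    and "\<bar>r * D - (DIM((real ^ 'n) \<times> real) + 4) * weighted_mass w p r\<bar>
      \<le> 3 * \<bar>a\<bar> * (r / snd p) * weighted_mass w p r"
proof -
  define U where "U = {0<..<snd p / 2}"
  define c :: "(real ^ 'n) \<times> real" where "c = (snd p / 2) *\<^sub>R One"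
  have One: "One \<bullet> b = 1" if "b \<in> Basis" for b :: "(real ^ 'n) \<times> real"
    using that by (rule inner_sum_Basis)
  have box: "cball p t \<subseteq> cbox (p - c) (p + c)" if "t \<in> U" for t
  proof
    fix z assume "z \<in> cball p t"
    then have zp: "\<bar>(z - p) \<bullet> b\<bar> \<le> t" if "b \<in> Basis" for b
      using Basis_le_norm[OF that, of "z - p"] by (simp add: dist_norm norm_minus_commute)
    show "z \<in> cbox (p - c) (p + c)"
      unfolding mem_box
    proof
      fix b :: "(real ^ 'n) \<times> real" assume b: "b \<in> Basis"
      have "c \<bullet> b = snd p / 2" unfolding c_def inner_scaleR_left One[OF b] by simp
      moreover have "t \<le> snd p / 2" using that by (simp add: U_def)
      ultimately show "(p - c) \<bullet> b \<le> z \<bullet> b \<and> z \<bullet> b \<le> (p + c) \<bullet> b"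
        using zp[OF b] unfolding inner_diff_left inner_add_left by linarith
    qed
  qed
  have sub: "cbox (p - c) (p + c) \<subseteq> half_space"
  proof
    fix z assume z: "z \<in> cbox (p - c) (p + c)"
    have b: "(0, 1) \<in> (Basis :: ((real ^ 'n) \<times> real) set)" by (simp add: Basis_prod_def)
    with z have "(p - c) \<bullet> (0, 1) \<le> z \<bullet> (0, 1)" unfolding mem_box by blast
    moreover have "c \<bullet> (0, 1) = snd p / 2" unfolding c_def using One[OF b] by simp
    moreover have "snd p > 0" using r by linarith
    ultimately show "z \<in> half_space" by (simp add: half_space_def inner_diff_left inner_prod_def)
  qed
  have wc: "continuous_on (cbox (p - c) (p + c)) w"
    using w_cont sub continuous_on_subset by blast
  have mass_box: "integral (cbox (p - c) (p + c)) (\<lambda>z. bump p t z ^ k * w z) = integral UNIV (\<lambda>z. bump p t z ^ k * w z)"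
    if "t \<in> U" "k > 0" for t k
  proof (rule integral_unique[symmetric], rule has_integral_on_superset)
    show "((\<lambda>z. bump p t z ^ k * w z) has_integral integral (cbox (p - c) (p + c)) (\<lambda>z. bump p t z ^ k * w z))
        (cbox (p - c) (p + c))"
      by (intro integrable_integral integrable_continuous continuous_intros continuous_on_bump wc)
    fix z assume "z \<notin> cbox (p - c) (p + c)"
    then have "bump p t z = 0" using box[OF that(1)] that(1) by (intro bump_eq_0) (auto simp: U_def)
    then show "bump p t z ^ k * w z = 0" using that by simp
  qed auto
  define D where "D = integral (cbox (p - c) (p + c)) (\<lambda>z. 4 * r * bump p r z * w z)"
  have rU: "r \<in> U" using r by (simp add: U_def)
  have "((\<lambda>t. integral (cbox (p - c) (p + c)) (\<lambda>z. (bump p t z)\<^sup>2 * w z)) has_field_derivative D) (at r within U)"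
    unfolding D_def
  proof (rule leibniz_rule_field_derivative)
    fix t z
    show "((\<lambda>t. (bump p t z)\<^sup>2 * w z) has_field_derivative 4 * t * bump p t z * w z) (at t within U)"
      by (rule DERIV_cmult_right[OF has_field_derivative_at_within[OF bump_radius_deriv]])
  next
    show "continuous_on (U \<times> cbox (p - c) (p + c)) (\<lambda>(t, z). 4 * t * bump p t z * w z)"
      unfolding case_prod_unfold bump_def
      by (intro continuous_intros continuous_on_compose2[OF wc]) auto
  qed (use r in \<open>auto simp: U_def intro!: integrable_continuous continuous_intros continuous_on_bump wc\<close>)
  then have "((\<lambda>t. integral (cbox (p - c) (p + c)) (\<lambda>z. (bump p t z)\<^sup>2 * w z)) has_field_derivative D) (at r)"
    by (subst (asm) at_within_open[OF rU]) (auto simp: U_def)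
  moreover have ev: "\<forall>\<^sub>F t in nhds r. integral (cbox (p - c) (p + c)) (\<lambda>z. (bump p t z)\<^sup>2 * w z) = weighted_mass w p t"
  proof (rule eventually_mono[of "\<lambda>t. t \<in> U"])
    show "\<forall>\<^sub>F t in nhds r. t \<in> U"
      using rU by (intro eventually_nhds_in_open) (auto simp: U_def)
  qed (simp add: weighted_mass_def mass_box)
  ultimately have der: "(weighted_mass w p has_real_derivative D) (at r)"
    using DERIV_cong_ev[OF refl ev refl, of D] by (blast dest: iffD1)
  have "r * D = 4 * r\<^sup>2 * integral (cbox (p - c) (p + c)) (\<lambda>z. bump p r z ^ 1 * w z)"
    unfolding D_def by (simp flip: integral_mult_right add: power2_eq_square mult_ac)
  also have "\<dots> = integral UNIV (\<lambda>z. 4 * r\<^sup>2 * (bump p r z * w z))"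
    using mass_box[OF rU zero_less_one] by (simp only: integral_mult_right power_one_right)
  also have "\<dots> = (DIM((real ^ 'n) \<times> real) + 4) * weighted_mass w p r
      + integral UNIV (\<lambda>z. (bump p r z)\<^sup>2 * (G z \<bullet> (z - p)))"
    by (rule radial_identity) (use r in auto)
  finally have "r * D - (DIM((real ^ 'n) \<times> real) + 4) * weighted_mass w p r
      = integral UNIV (\<lambda>z. (bump p r z)\<^sup>2 * (G z \<bullet> (z - p)))" by (simp del: DIM_prod)
  with radial_gradient_bound[of r p] r der that show thesis by (simp del: DIM_prod)
qed

end

section \<open>An almost mean value property and Harnack's inequality\<close>

text \<open>
  The differential inequality bounds the logarithmic derivative of \<open>f t / t ^ k\<close> by \<open>c\<close> on both
  sides; equivalently, this quotient becomes increasing after multiplication by \<open>exp (c * t)\<close> and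
  decreasing after multiplication by \<open>exp (- c * t)\<close>.
\<close>

lemma power_scaling_bound:
  fixes f :: "real \<Rightarrow> real"
  assumes s: "0 < s" "s \<le> r"
    and der: "\<And>t. s \<le> t \<Longrightarrow> t \<le> r \<Longrightarrow>
      \<exists>D. (f has_real_derivative D) (at t) \<and> \<bar>t * D - real k * f t\<bar> \<le> c * t * f t"
  shows "f s / s ^ k \<le> exp (c * (r - s)) * (f r / r ^ k)"
    and "f r / r ^ k \<le> exp (c * (r - s)) * (f s / s ^ k)"
proof -
  have d: "\<exists>D. ((\<lambda>t. f t * exp (b * t) / t ^ k) has_real_derivative
      exp (b * t) / (t * t ^ k) * (t * D + b * t * f t - real k * f t)) (at t)
      \<and> \<bar>t * D - real k * f t\<bar> \<le> c * t * f t" if t: "s \<le> t" "t \<le> r" for b t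
  proof -
    obtain D where D: "(f has_real_derivative D) (at t)" "\<bar>t * D - real k * f t\<bar> \<le> c * t * f t"
      using der[OF t] by blast
    have t0: "t > 0" using t s by simp
    have pow: "((\<lambda>t. t ^ k) has_real_derivative real k * t ^ k / t) (at t)"
      by (rule DERIV_cong[OF DERIV_pow]) (use t0 in \<open>cases k; simp\<close>)
    have "((\<lambda>t. exp (b * t)) has_real_derivative exp (b * t) * b) (at t)"
      by (auto intro!: derivative_eq_intros)
    from DERIV_divide[OF DERIV_mult[OF D(1) this] pow]
    have "((\<lambda>t. f t * exp (b * t) / t ^ k) has_real_derivative
      exp (b * t) / (t * t ^ k) * (t * D + b * t * f t - real k * f t)) (at t)"
      by (rule DERIV_cong) (use t0 in \<open>auto simp: field_simps\<close>)
    with D(2) show ?thesis by blast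
  qed
  have pos: "exp (b * t) / (t * t ^ k) \<ge> 0" if "s \<le> t" for b t
    using that s by simp
  have X: "f s * exp (c * s) / s ^ k \<le> f r * exp (c * r) / r ^ k"
  proof (rule DERIV_nonneg_imp_nondecreasing[OF s(2)])
    fix t assume t: "s \<le> t" "t \<le> r"
    show "\<exists>y. ((\<lambda>t. f t * exp (c * t) / t ^ k) has_real_derivative y) (at t) \<and> 0 \<le> y"
      using d[OF t, of c] pos[OF t(1), of c] by (fastforce intro!: mult_nonneg_nonneg simp: abs_le_iff)
  qed
  show "f s / s ^ k \<le> exp (c * (r - s)) * (f r / r ^ k)"
    using divide_right_mono[OF X, of "exp (c * s)"]
    by (simp add: exp_diff right_diff_distrib mult_ac)
  have X: "f r * exp (- c * r) / r ^ k \<le> f s * exp (- c * s) / s ^ k"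
  proof (rule DERIV_nonpos_imp_nonincreasing[OF s(2)])
    fix t assume t: "s \<le> t" "t \<le> r"
    show "\<exists>y. ((\<lambda>t. f t * exp (- c * t) / t ^ k) has_real_derivative y) (at t) \<and> y \<le> 0"
      using d[OF t, of "- c"] pos[OF t(1), of "- c"] by (fastforce intro!: mult_nonneg_nonpos simp: abs_le_iff)
  qed
  have "f r * exp (- c * r) / r ^ k * exp (c * r) = f r / r ^ k"
    by (simp add: exp_minus)
  then show "f r / r ^ k \<le> exp (c * (r - s)) * (f s / s ^ k)"
    using mult_right_mono[OF X, of "exp (c * r)"]
    by (simp add: exp_diff exp_minus right_diff_distrib divide_inverse mult_ac)
qed

text \<open>
  On the ball of radius \<open>r\<close> around \<open>p\<close> the second paraboloid is at least
  \<open>r'\<^sup>2 - (norm (p - q) + r)\<^sup>2\<close>, which is at least the maximum \<open>r\<^sup>2\<close> of the first one.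
\<close>

lemma bump_le_bump:
  assumes "0 \<le> r" "r\<^sup>2 + (norm (p - q) + r)\<^sup>2 \<le> r'\<^sup>2"
  shows "bump p r z \<le> bump q r' z"
proof (cases "z \<in> cball p r")
  case True
  then have "norm (z - q) \<le> norm (p - q) + r"
    using norm_triangle_ineq[of "p - q" "z - p"] by (simp add: dist_norm norm_minus_commute)
  then have "(norm (z - q))\<^sup>2 \<le> (norm (p - q) + r)\<^sup>2" by (intro power_mono) auto
  then have "r\<^sup>2 \<le> bump q r' z" using assms unfolding bump_def by linarith
  with bump_le[of p r z] show ?thesis by linarith
qed (use bump_eq_0[OF assms(1), of z p] bump_nonneg[of q r' z] in simp)

lemma weighted_mass_one_pos:
  assumes "r > 0"
  shows "weighted_mass (\<lambda>_. 1) p r > 0"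
proof -
  let ?C = "cbox (p - One) (p + One)"
  have cont: "continuous_on A (\<lambda>z. (bump p r z)\<^sup>2)" for A
    by (intro continuous_intros continuous_on_bump)
  have p: "p \<in> box (p - One) (p + One)"
    by (auto simp: mem_box inner_diff_left inner_add_left inner_sum_Basis)
  then have "p \<in> ?C" using box_subset_cbox by blast
  moreover have "(bump p r p)\<^sup>2 \<noteq> 0" using assms by (simp add: bump_def)
  moreover have "integral ?C (\<lambda>z. (bump p r z)\<^sup>2) = 0 \<longleftrightarrow> (\<forall>z\<in>?C. (bump p r z)\<^sup>2 = 0)"
    by (rule integral_cbox_eq_0_iff[OF cont]) (use p in auto)
  ultimately have "integral ?C (\<lambda>z. (bump p r z)\<^sup>2) \<noteq> 0" by blast
  moreover have "integral ?C (\<lambda>z. (bump p r z)\<^sup>2) \<ge> 0"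
    by (intro integral_nonneg integrable_continuous cont) auto
  moreover have "integral ?C (\<lambda>z. (bump p r z)\<^sup>2) \<le> integral UNIV (\<lambda>z. (bump p r z)\<^sup>2)"
    by (intro integral_subset_le integrable_continuous cont
        integrable_compact_support[OF _ compact_cball[of p r]])
       (use assms in \<open>auto simp: bump_eq_0\<close>)
  ultimately show ?thesis by (simp add: weighted_mass_def)
qed

context La_solution
begin

text \<open>
  The exponent \<open>CARD('n) + 5\<close> is the dimension \<open>CARD('n) + 1\<close> plus four, as in the radial identity. The
  accumulated error is \<open>3 * \<bar>a\<bar> * (r - s) / snd p\<close>, which stays below \<open>2 * \<bar>a\<bar>\<close> for radii up to half the height.
\<close>

lemma weighted_mass_scaling:
  assumes "0 < s" "s \<le> r" "2 * r < snd p"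
  shows "weighted_mass w p s / s ^ (CARD('n) + 5) \<le> exp (2 * \<bar>a\<bar>) * (weighted_mass w p r / r ^ (CARD('n) + 5))"
    and "weighted_mass w p r / r ^ (CARD('n) + 5) \<le> exp (2 * \<bar>a\<bar>) * (weighted_mass w p s / s ^ (CARD('n) + 5))"
proof -
  have mass_nonneg: "0 \<le> weighted_mass w p t / t ^ (CARD('n) + 5)" if "0 < t" "t \<le> r" for t
  proof -
    have "0 \<le> (bump p t z)\<^sup>2 * w z" for z
    proof (cases "z \<in> half_space")
      case False
      then have "bump p t z = 0"
        using cball_subset_half_space[of t p] that assms by (intro bump_eq_0) auto
      then show ?thesis by simp
    qed (use pos in \<open>auto simp: less_imp_le\<close>)
    then show ?thesis using that
      bump_integrable[of t p w 2] assms w_cont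
      unfolding weighted_mass_def by (auto intro!: integral_nonneg divide_nonneg_nonneg)
  qed
  have "3 * \<bar>a\<bar> / snd p * (r - s) = \<bar>a\<bar> * (3 * (r - s) / snd p)" by simp
  also have "\<dots> \<le> \<bar>a\<bar> * 2"
    using assms by (intro mult_left_mono) (auto simp: field_simps)
  finally have e: "exp (3 * \<bar>a\<bar> / snd p * (r - s)) \<le> exp (2 * \<bar>a\<bar>)" by simp
  have der: "\<exists>D. (weighted_mass w p has_real_derivative D) (at t) \<and>
      \<bar>t * D - real (CARD('n) + 5) * weighted_mass w p t\<bar> \<le> 3 * \<bar>a\<bar> / snd p * t * weighted_mass w p t"
    if "s \<le> t" "t \<le> r" for t
  proof -
    have t: "0 < t" "2 * t < snd p" using that assms by auto
    obtain D where "(weighted_mass w p has_real_derivative D) (at t)"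
      "\<bar>t * D - (DIM((real ^ 'n) \<times> real) + 4) * weighted_mass w p t\<bar> \<le> 3 * \<bar>a\<bar> * (t / snd p) * weighted_mass w p t"
      using weighted_mass_deriv[OF t] by blast
    then show ?thesis by (intro exI[of _ D]) (simp add: algebra_simps)
  qed
  show "weighted_mass w p s / s ^ (CARD('n) + 5) \<le> exp (2 * \<bar>a\<bar>) * (weighted_mass w p r / r ^ (CARD('n) + 5))"
    using power_scaling_bound(1)[OF assms(1,2) der] mult_right_mono[OF e mass_nonneg[of r]] assms
    by (simp)
  show "weighted_mass w p r / r ^ (CARD('n) + 5) \<le> exp (2 * \<bar>a\<bar>) * (weighted_mass w p s / s ^ (CARD('n) + 5))"
    using power_scaling_bound(2)[OF assms(1,2) der] mult_right_mono[OF e mass_nonneg[of s]] assms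
    by (simp)
qed

end

text \<open>
  Constants solve the equation with \<open>a = 0\<close>. For them the scaling estimate holds with the
  factor \<open>exp 0 = 1\<close> in both directions, which gives the exact scaling of the mass of the bump without
  computing it.
\<close>

interpretation const_one: La_solution 0 "\<lambda>_. 1" "\<lambda>_. 0" "\<lambda>_ _. 0"
  by unfold_locales (auto simp: zero_prod_def[symmetric])

lemma weighted_mass_one_scaling:
  fixes p :: "(real ^ 'n) \<times> real"
  assumes "0 < s" "s \<le> r" "2 * r < snd p"
  shows "weighted_mass (\<lambda>_. 1) p s / s ^ (CARD('n) + 5) = weighted_mass (\<lambda>_. 1) p r / r ^ (CARD('n) + 5)"
  using const_one.weighted_mass_scaling[OF assms] by (simp)

context La_solution
begin

lemma weighted_mass_mono:
  assumes "0 \<le> r" "r < snd p" "continuous_on half_space f" "continuous_on half_space g"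
    "\<And>z. z \<in> cball p r \<Longrightarrow> f z \<le> g z"
  shows "weighted_mass f p r \<le> weighted_mass g p r"
  unfolding weighted_mass_def
proof (rule integral_le)
  fix z
  show "(bump p r z)\<^sup>2 * f z \<le> (bump p r z)\<^sup>2 * g z"
    by (cases "z \<in> cball p r") (auto intro!: mult_left_mono assms(5) simp: bump_eq_0 assms(1))
qed (rule bump_integrable[OF assms(1,2)]; use assms in simp)+

text \<open>
  The averages over two concentric balls are comparable by the scaling estimates, and as the
  smaller radius tends to 0 the average tends to \<open>w p\<close>.
\<close>

lemma almost_mean_value:
  assumes r: "0 < r" "2 * r < snd p"
  shows "w p * weighted_mass (\<lambda>_. 1) p r \<le> exp (2 * \<bar>a\<bar>) * weighted_mass w p r"
    and "weighted_mass w p r \<le> exp (2 * \<bar>a\<bar>) * w p * weighted_mass (\<lambda>_. 1) p r"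
proof -
  let ?M = "weighted_mass w p" and ?I = "weighted_mass (\<lambda>_. 1) p"
  have const: "weighted_mass (\<lambda>_. c) p t = c * ?I t" for c t
    unfolding weighted_mass_def by (subst integral_mult_right[symmetric]) (simp add: mult.commute)
  have small: "\<exists>s. 0 < s \<and> s \<le> r \<and> (w p - \<epsilon>) * ?I s \<le> ?M s \<and> ?M s \<le> (w p + \<epsilon>) * ?I s" if "\<epsilon> > 0" for \<epsilon>
  proof -
    have "p \<in> half_space" using r by (simp add: half_space_def)
    then have "isCont w p" using w_cont open_half_space continuous_on_eq_continuous_at by blast
    then obtain d where d: "d > 0" "\<And>z. dist z p < d \<Longrightarrow> dist (w z) (w p) < \<epsilon>"
      using \<open>\<epsilon> > 0\<close> unfolding continuous_at_eps_delta by blast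
    define s where "s = min r (d / 2)"
    have s: "0 < s" "s \<le> r" "s < d" using r d by (auto simp: s_def)
    have "w p - \<epsilon> \<le> w z \<and> w z \<le> w p + \<epsilon>" if "z \<in> cball p s" for z
      using d(2)[of z] that s by (auto simp: dist_commute dist_real_def abs_le_iff)
    moreover have "0 \<le> s" "s < snd p" using s r by auto
    ultimately have "weighted_mass (\<lambda>_. w p - \<epsilon>) p s \<le> ?M s" "?M s \<le> weighted_mass (\<lambda>_. w p + \<epsilon>) p s"
      by (intro weighted_mass_mono w_cont continuous_on_const; blast)+
    then show ?thesis
      unfolding const[of "w p - \<epsilon>"] const[of "w p + \<epsilon>"] using s by blast
  qed
  have Ipos: "?I t > 0" if "t > 0" for t using weighted_mass_one_pos[OF that] .
  have ratio: "?M s / ?I s \<le> exp (2 * \<bar>a\<bar>) * (?M r / ?I r)" "?M r / ?I r \<le> exp (2 * \<bar>a\<bar>) * (?M s / ?I s)"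
    if s: "0 < s" "s \<le> r" for s
  proof -
    have q: "?M t / ?I t = (?M t / t ^ (CARD('n) + 5)) / (?I t / t ^ (CARD('n) + 5))" if "t > 0" for t
      using that by simp
    have I: "?I s / s ^ (CARD('n) + 5) = ?I r / r ^ (CARD('n) + 5)" by (rule weighted_mass_one_scaling[OF s r(2)])
    have pos: "?I r / r ^ (CARD('n) + 5) > 0" using Ipos[OF r(1)] r by simp
    show "?M s / ?I s \<le> exp (2 * \<bar>a\<bar>) * (?M r / ?I r)"
      unfolding q[OF s(1)] q[OF r(1)] I
      using divide_right_mono[OF weighted_mass_scaling(1)[OF s r(2)], of "?I r / r ^ (CARD('n) + 5)"] pos
      by (simp only: times_divide_eq_right less_imp_le)
    show "?M r / ?I r \<le> exp (2 * \<bar>a\<bar>) * (?M s / ?I s)"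
      unfolding q[OF s(1)] q[OF r(1)] I
      using divide_right_mono[OF weighted_mass_scaling(2)[OF s r(2)], of "?I r / r ^ (CARD('n) + 5)"] pos
      by (simp only: times_divide_eq_right less_imp_le)
  qed
  have "w p \<le> exp (2 * \<bar>a\<bar>) * (?M r / ?I r)"
  proof (rule field_le_epsilon)
    fix \<epsilon> :: real assume "\<epsilon> > 0"
    then obtain s where s: "0 < s" "s \<le> r" "(w p - \<epsilon>) * ?I s \<le> ?M s" using small by blast
    have "w p - \<epsilon> \<le> ?M s / ?I s" using s(3) Ipos[OF s(1)] by (simp add: pos_le_divide_eq)
    with ratio(1)[OF s(1,2)] show "w p \<le> exp (2 * \<bar>a\<bar>) * (?M r / ?I r) + \<epsilon>" by linarith
  qed
  then show "w p * ?I r \<le> exp (2 * \<bar>a\<bar>) * ?M r"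
    using Ipos[OF r(1)] by (simp add: field_simps)
  have "?M r / ?I r \<le> exp (2 * \<bar>a\<bar>) * w p"
  proof (rule field_le_epsilon)
    fix \<epsilon> :: real assume "\<epsilon> > 0"
    then have "\<epsilon> / exp (2 * \<bar>a\<bar>) > 0" by simp
    from small[OF this] obtain s where s: "0 < s" "s \<le> r" "?M s \<le> (w p + \<epsilon> / exp (2 * \<bar>a\<bar>)) * ?I s" by blast
    have "?M s / ?I s \<le> w p + \<epsilon> / exp (2 * \<bar>a\<bar>)" using s(3) Ipos[OF s(1)] by (simp add: pos_divide_le_eq)
    then have "exp (2 * \<bar>a\<bar>) * (?M s / ?I s) \<le> exp (2 * \<bar>a\<bar>) * (w p + \<epsilon> / exp (2 * \<bar>a\<bar>))"
      by (intro mult_left_mono) auto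
    with ratio(2)[OF s(1,2)] show "?M r / ?I r \<le> exp (2 * \<bar>a\<bar>) * w p + \<epsilon>"
      by (simp add: distrib_left)
  qed
  then show "?M r \<le> exp (2 * \<bar>a\<bar>) * w p * ?I r"
    using Ipos[OF r(1)] by (simp add: field_simps)
qed

text \<open>
  Two mean value comparisons contribute \<open>exp (2 * \<bar>a\<bar>)\<close> each; the power of 5 is the ratio of the masses of
  the bumps with radii \<open>5 * r\<close> and \<open>r\<close>.
\<close>

definition harnack_const :: real where
  "harnack_const = exp (4 * \<bar>a\<bar>) * 5 ^ (CARD('n) + 5)"

lemma harnack_const_ge_1: "harnack_const \<ge> 1"
proof -
  have "1 * 1 \<le> exp (4 * \<bar>a\<bar>) * (5 ^ (CARD('n) + 5) :: real)"
    by (intro mult_mono) auto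
  then show ?thesis by (simp add: harnack_const_def)
qed

text \<open>
  Three radii, \<open>r\<close>, \<open>3 * r\<close> and \<open>5 * r\<close> with \<open>r = snd p / 16\<close>, make the bumps around \<open>p\<close>, \<open>q\<close> and again \<open>p\<close>
  increase, because \<open>1\<^sup>2 + 2\<^sup>2 \<le> 3\<^sup>2\<close> and \<open>3\<^sup>2 + 4\<^sup>2 = 5\<^sup>2\<close>, and keep all balls at a safe distance from the
  boundary. The first comparison is used for the mass of \<open>w\<close>, the second one for the mass of the
  constant 1, by which the averages are normalised.
\<close>

lemma harnack:
  assumes p: "snd p > 0" and pq: "norm (p - q) \<le> snd p / 16"
  shows "w p \<le> harnack_const * w q"
proof -
  define Y where "Y = snd p"
  define d where "d = norm (p - q)"
  have Y: "Y > 0" and d: "0 \<le> d" "d \<le> Y / 16" using p pq by (auto simp: Y_def d_def)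
  have "\<bar>snd p - snd q\<bar> \<le> d"
    unfolding d_def by (metis dist_norm dist_real_def dist_snd_le)
  then have q: "snd q \<ge> 15 / 16 * Y" using d unfolding Y_def by linarith
  have sq: "r\<^sup>2 + (d + r)\<^sup>2 \<le> (r')\<^sup>2" if "r \<ge> 0" "r\<^sup>2 + (Y / 16 + r)\<^sup>2 \<le> r'\<^sup>2" for r r'
    using power_mono[of "d + r" "Y / 16 + r" 2] d that by linarith
  let ?I = "weighted_mass (\<lambda>_. 1)"
  define r where "r = Y / 16"
  have r: "r > 0" "Y = 16 * r" using Y by (auto simp: r_def)
  have 1: "bump p r z \<le> bump q (3 * r) z" for z
    using r sq[of r "3 * r"] by (intro bump_le_bump) (auto simp: d_def[symmetric] power2_eq_square)
  have 2: "bump q (3 * r) z \<le> bump p (5 * r) z" for z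
    using r sq[of "3 * r" "5 * r"]
    by (intro bump_le_bump) (auto simp: norm_minus_commute[of q] d_def[symmetric] power2_eq_square)
  have wm: "weighted_mass w p r \<le> weighted_mass w q (3 * r)"
    unfolding weighted_mass_def
  proof (rule integral_le)
    fix z
    show "(bump p r z)\<^sup>2 * w z \<le> (bump q (3 * r) z)\<^sup>2 * w z"
    proof (cases "z \<in> cball p r")
      case True
      then have "z \<in> half_space" using cball_subset_half_space[of r p] r Y_def by auto
      then show ?thesis using pos[of z] by (intro mult_right_mono power_mono 1 bump_nonneg) auto
    next
      case False
      then have "bump p r z = 0" using r by (intro bump_eq_0) auto
      moreover have "(bump q (3 * r) z)\<^sup>2 * w z \<ge> 0"
      proof (cases "z \<in> half_space")
        case False
        then have "bump q (3 * r) z = 0"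
          using cball_subset_half_space[of "3 * r" q] r q by (intro bump_eq_0) auto
        then show ?thesis by simp
      qed (use pos[of z] in auto)
      ultimately show ?thesis by simp
    qed
  qed (use r q Y_def in \<open>auto intro!: bump_integrable w_cont\<close>)
  have "?I q (3 * r) \<le> ?I p (5 * r)"
    unfolding weighted_mass_def
    by (intro integral_le const_one.bump_integrable mult_right_mono power_mono 2 bump_nonneg)
       (use r q Y_def in auto)
  also have "?I p (5 * r) = 5 ^ (CARD('n) + 5) * ?I p r"
    using weighted_mass_one_scaling[of r "5 * r" p] r Y_def
    by (simp add: power_mult_distrib field_simps)
  finally have Iq: "?I q (3 * r) \<le> 5 ^ (CARD('n) + 5) * ?I p r" .
  have Ip: "?I p r > 0" using weighted_mass_one_pos[OF r(1)] .
  have wq: "w q > 0" using pos[of q] q Y by (simp add: half_space_def)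
  have "w p * ?I p r \<le> exp (2 * \<bar>a\<bar>) * weighted_mass w p r"
    by (rule almost_mean_value) (use r Y_def in auto)
  also have "\<dots> \<le> exp (2 * \<bar>a\<bar>) * weighted_mass w q (3 * r)"
    using wm by (intro mult_left_mono) auto
  also have "\<dots> \<le> exp (2 * \<bar>a\<bar>) * (exp (2 * \<bar>a\<bar>) * w q * ?I q (3 * r))"
    by (intro mult_left_mono almost_mean_value) (use r q Y_def in auto)
  also have "\<dots> \<le> exp (2 * \<bar>a\<bar>) * (exp (2 * \<bar>a\<bar>) * w q * (5 ^ (CARD('n) + 5) * ?I p r))"
    using wq by (intro mult_left_mono Iq) auto
  also have "\<dots> = harnack_const * w q * ?I p r"
  proof -
    have "exp (4 * \<bar>a\<bar>) = exp (2 * \<bar>a\<bar>) * exp (2 * \<bar>a\<bar>)" by (simp flip: exp_add)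
    then show ?thesis by (simp only: harnack_const_def mult_ac)
  qed
  finally show ?thesis using Ip by simp
qed

end

section \<open>Growth in the interior\<close>

context La_solution
begin

lemma harnack_vertical:
  assumes "0 < y" "y \<le> Y" "Y \<le> (17 / 16) ^ j * y"
  shows "w (x, y) \<le> harnack_const ^ j * w (x, Y) \<and> w (x, Y) \<le> harnack_const ^ j * w (x, y)"
  using assms
proof (induction j arbitrary: Y)
  case 0
  then show ?case by simp
next
  case (Suc j)
  have K: "harnack_const \<ge> 1" "harnack_const \<ge> 0" using harnack_const_ge_1 by auto
  have wpos: "w (x, y) > 0" "w (x, Y) > 0" using pos Suc.prems by (auto simp: half_space_def)
  show ?case
  proof (cases "Y \<le> (17 / 16) ^ j * y")
    case True
    have "harnack_const ^ j \<le> harnack_const ^ Suc j" using K by (intro power_increasing) auto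
    then have "harnack_const ^ j * w (x, Y) \<le> harnack_const ^ Suc j * w (x, Y)"
      "harnack_const ^ j * w (x, y) \<le> harnack_const ^ Suc j * w (x, y)"
      using wpos by (auto intro!: mult_right_mono)
    with Suc.IH[OF Suc.prems(1,2) True] show ?thesis by linarith
  next
    case False
    define Z where "Z = (17 / 16) ^ j * y"
    have "1 * y \<le> Z" unfolding Z_def using Suc.prems(1) by (intro mult_right_mono) auto
    then have Z: "y \<le> Z" "Z < Y" "Y \<le> 17 / 16 * Z" "Z > 0"
      using False Suc.prems by (auto simp: Z_def)
    have IH: "w (x, y) \<le> harnack_const ^ j * w (x, Z)" "w (x, Z) \<le> harnack_const ^ j * w (x, y)"
      using Suc.IH[of Z] Suc.prems(1) Z(1) by (auto simp: Z_def)
    have step: "w (x, Z) \<le> harnack_const * w (x, Y)" "w (x, Y) \<le> harnack_const * w (x, Z)"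
      using Z by (auto intro!: harnack simp: norm_prod_def)
    have "harnack_const ^ j * w (x, Z) \<le> harnack_const ^ j * (harnack_const * w (x, Y))"
      using K by (intro mult_left_mono step) auto
    moreover have "harnack_const * w (x, Z) \<le> harnack_const * (harnack_const ^ j * w (x, y))"
      using K by (intro mult_left_mono IH) auto
    ultimately show ?thesis using IH(1) step(2) by (simp add: mult_ac)
  qed
qed

text \<open>
  The number of Harnack steps between the heights \<open>y\<close> and \<open>Y\<close> is logarithmic in \<open>Y / y\<close>, so the product of
  the constants is a power of \<open>Y / y\<close>. The exponent \<open>m\<close> comes from bounding the constant of a single
  step by a power of the step ratio \<open>17 / 16\<close>.
\<close>

lemma harnack_vertical_power:
  obtains m where "m > 0"
    and "\<And>x y Y. 0 < y \<Longrightarrow> y \<le> Y \<Longrightarrow> w (x, y) \<le> harnack_const * (Y / y) ^ m * w (x, Y)"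
    and "\<And>x y Y. 0 < y \<Longrightarrow> y \<le> Y \<Longrightarrow> w (x, Y) \<le> harnack_const * (Y / y) ^ m * w (x, y)"
proof -
  have K: "harnack_const \<ge> 1" using harnack_const_ge_1 .
  obtain m where "harnack_const < (17 / 16) ^ m"
    using real_arch_pow[of "17 / 16 :: real"] by auto
  also have "(17 / 16 :: real) ^ m \<le> (17 / 16) ^ Suc m" by (intro power_increasing) auto
  finally have m: "harnack_const \<le> (17 / 16) ^ Suc m" by simp
  have j: "\<exists>j. Y \<le> (17 / 16) ^ j * y \<and> harnack_const ^ j \<le> harnack_const * (Y / y) ^ Suc m"
    if y: "0 < y" "y \<le> Y" for y Y
  proof -
    have ex: "\<exists>j. Y / y < (17 / 16) ^ j" using real_arch_pow[of "17 / 16 :: real"] by auto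
    define j where "j = (LEAST j. Y / y < (17 / 16) ^ j)"
    have "Y / y < (17 / 16) ^ j" unfolding j_def by (rule LeastI_ex[OF ex])
    then have 1: "Y \<le> (17 / 16) ^ j * y" using y by (simp add: field_simps)
    have "j \<noteq> 0" using \<open>Y / y < (17 / 16) ^ j\<close> y by (auto intro!: gr0I simp: field_simps)
    then obtain i where i: "j = Suc i" using not0_implies_Suc by blast
    have "\<not> Y / y < (17 / 16) ^ i"
      using not_less_Least[of i "\<lambda>j. Y / y < (17 / 16) ^ j"] i by (simp add: j_def)
    then have "((17 / 16) ^ i) ^ Suc m \<le> (Y / y) ^ Suc m" by (intro power_mono) auto
    moreover have "harnack_const ^ i \<le> ((17 / 16) ^ Suc m) ^ i"
      using m K by (intro power_mono) auto
    moreover have "((17 / 16 :: real) ^ Suc m) ^ i = ((17 / 16) ^ i) ^ Suc m"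
      by (simp only: power_mult[symmetric] mult.commute)
    ultimately have "harnack_const ^ i \<le> (Y / y) ^ Suc m" by linarith
    then have "harnack_const * harnack_const ^ i \<le> harnack_const * (Y / y) ^ Suc m"
      using K by (intro mult_left_mono) auto
    with 1 show ?thesis by (intro exI[of _ j]) (simp add: i)
  qed
  have *: "w (x, y) \<le> harnack_const * (Y / y) ^ Suc m * w (x, Y) \<and> w (x, Y) \<le> harnack_const * (Y / y) ^ Suc m * w (x, y)"
    if y: "0 < y" "y \<le> Y" for x y Y
  proof -
    obtain j where j: "Y \<le> (17 / 16) ^ j * y" "harnack_const ^ j \<le> harnack_const * (Y / y) ^ Suc m"
      using j[OF y] by blast
    have "w (x, y) > 0" "w (x, Y) > 0" using pos y by (auto simp: half_space_def)
    then show ?thesis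
      using mult_right_mono[OF j(2), of "w (x, Y)"] mult_right_mono[OF j(2), of "w (x, y)"]
        harnack_vertical[OF y j(1), of x] by linarith
  qed
  show thesis by (rule that[of "Suc m"]) (use * in \<open>blast+\<close>)
qed

text \<open>
  The steps divide the segment from \<open>x\<close> to \<open>x'\<close> into \<open>j\<close> equal parts, each short compared with the height.
\<close>

lemma harnack_horizontal:
  assumes "R > 0" "norm (x - x') \<le> real j * (R / 16)"
  shows "w (x, R) \<le> harnack_const ^ j * w (x', R)"
  using assms(2)
proof (induction j arbitrary: x)
  case 0
  then show ?case by simp
next
  case (Suc j)
  have K: "harnack_const \<ge> 0" using harnack_const_ge_1 by auto
  define x1 where "x1 = x - (1 / real (Suc j)) *\<^sub>R (x - x')"
  have "norm (x - x1) = (1 / real (Suc j)) * norm (x - x')"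
    by (simp add: x1_def)
  also have "\<dots> \<le> (1 / real (Suc j)) * (real (Suc j) * (R / 16))"
    by (intro mult_left_mono Suc.prems) auto
  finally have 1: "norm (x - x1) \<le> R / 16" by simp
  have "x1 - x' = (1 - 1 / real (Suc j)) *\<^sub>R (x - x')"
    by (simp add: x1_def algebra_simps)
  also have "1 - 1 / real (Suc j) = real j / real (Suc j)" by (simp add: field_simps)
  finally have "norm (x1 - x') = (real j / real (Suc j)) * norm (x - x')" by simp
  also have "\<dots> \<le> (real j / real (Suc j)) * (real (Suc j) * (R / 16))"
    by (intro mult_left_mono Suc.prems) auto
  finally have "norm (x1 - x') \<le> real j * (R / 16)" by simp
  from Suc.IH[OF this] have "harnack_const * w (x1, R) \<le> harnack_const * (harnack_const ^ j * w (x', R))"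
    using K by (intro mult_left_mono) auto
  moreover have "w (x, R) \<le> harnack_const * w (x1, R)"
    using 1 assms(1) by (intro harnack) (auto simp: norm_prod_def)
  ultimately show ?case by simp
qed

end

section \<open>From the interior to the boundary\<close>

lemma second_derivative_nonpos_at_local_max:
  fixes f f' :: "real \<Rightarrow> real"
  assumes e: "e > 0"
    and f: "\<And>t. \<bar>t\<bar> < e \<Longrightarrow> (f has_real_derivative f' t) (at t)"
    and f': "(f' has_real_derivative l) (at 0)"
    and max: "\<And>t. \<bar>t\<bar> < e \<Longrightarrow> f t \<le> f 0"
  shows "f' 0 = 0" "l \<le> 0"
proof -
  show f0: "f' 0 = 0"
  proof (rule DERIV_local_max[OF f e])
    show "\<bar>0\<bar> < e" using e by simp
    show "\<forall>t. \<bar>0 - t\<bar> < e \<longrightarrow> f t \<le> f 0" using max by simp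
  qed
  show "l \<le> 0"
  proof (rule ccontr)
    assume "\<not> l \<le> 0"
    then have "l > 0" by simp
    from DERIV_pos_inc_right[OF f' this]
    obtain d where d: "d > 0" "\<And>h. 0 < h \<Longrightarrow> h < d \<Longrightarrow> f' 0 < f' (0 + h)"
      by blast
    define t where "t = min d e / 2"
    have t: "0 < t" "t < d" "t < e" using d e by (auto simp: t_def)
    have "f 0 < f t"
    proof (rule DERIV_pos_imp_increasing_open[OF t(1)])
      show "continuous_on {0..t} f"
      proof (rule DERIV_continuous_on)
        fix s assume "s \<in> {0..t}"
        then have "\<bar>s\<bar> < e" using t by simp
        then show "(f has_real_derivative f' s) (at s within {0..t})"
          by (rule has_field_derivative_at_within[OF f])
      qed
      fix s assume s: "0 < s" "s < t"
      then have "\<bar>s\<bar> < e" "0 < f' s" using d(2)[of s] t f0 by simp_all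
      then show "\<exists>y. (f has_real_derivative y) (at s) \<and> 0 < y"
        using f by blast
    qed
    with max[of t] t show False by simp
  qed
qed

context La_solution
begin

text \<open>
  For \<open>(norm (x - x0))\<^sup>2 - b * y\<^sup>2\<close> the operator of the equation, the Laplacian plus \<open>a / y\<close> times the
  derivative in \<open>y\<close>, gives the constant \<open>2 * n - 2 * b * (1 + a)\<close>, with \<open>n\<close> the number of boundary variables.
  It is negative for the \<open>b\<close> considered here, so \<open>w\<close> minus a positive multiple of this paraboloid is a
  strict subsolution.
\<close>

lemma no_interior_max:
  assumes z: "z \<in> half_space" and c: "c > 0" and b: "(1 + a) * b > real CARD('n)" and e: "e > 0"
    and max: "\<And>z'. z' \<in> ball z e \<Longrightarrow>
      w z' - c * ((norm (fst z' - x0))\<^sup>2 - b * (snd z')\<^sup>2) \<le> w z - c * ((norm (fst z - x0))\<^sup>2 - b * (snd z)\<^sup>2)"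
  shows False
proof -
  define f where "f z = w z - c * ((norm (fst z - x0))\<^sup>2 - b * (snd z)\<^sup>2)" for z
  have y: "snd z > 0" using z by (simp add: half_space_def)
  obtain e' where e': "e' > 0" "e' \<le> e" "ball z e' \<subseteq> half_space"
  proof -
    obtain d where "d > 0" "ball z d \<subseteq> half_space"
      using open_half_space z open_contains_ball by blast
    then show thesis using e by (intro that[of "min d e"]) auto
  qed
  let ?B = "Basis :: ((real ^ 'n) \<times> real) set"
  have key: "G z \<bullet> i = c * (2 * ((fst z - x0) \<bullet> fst i) - 2 * b * snd z * snd i) \<and>
      H z i \<bullet> i \<le> c * (2 * (norm (fst i))\<^sup>2 - 2 * b * (snd i)\<^sup>2)" if i: "i \<in> ?B" for i
  proof -
    define g where "g t = G (z + t *\<^sub>R i) \<bullet> i - c * (2 * ((fst (z + t *\<^sub>R i) - x0) \<bullet> fst i) - 2 * b * snd (z + t *\<^sub>R i) * snd i)" for t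
    have inball: "z + t *\<^sub>R i \<in> ball z e'" if "\<bar>t\<bar> < e'" for t
      using that i by (simp add: dist_norm)
    have 1: "((\<lambda>t. f (z + t *\<^sub>R i)) has_real_derivative g t) (at t)" if "\<bar>t\<bar> < e'" for t
    proof -
      have "((\<lambda>s. w ((z + t *\<^sub>R i) + (s - t) *\<^sub>R i)) has_real_derivative G (z + t *\<^sub>R i) \<bullet> i) (at t)"
        using DERIV_shift[of "\<lambda>s. w ((z + t *\<^sub>R i) + (s - t) *\<^sub>R i)" "G (z + t *\<^sub>R i) \<bullet> i" 0 t]
          w_line_deriv[of "z + t *\<^sub>R i" i] inball[OF that] e'(3) by auto
      then have w': "((\<lambda>s. w (z + s *\<^sub>R i)) has_real_derivative G (z + t *\<^sub>R i) \<bullet> i) (at t)"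
        by (simp add: algebra_simps)
      have "((\<lambda>t. (norm (fst (z + t *\<^sub>R i) - x0))\<^sup>2 - b * (snd (z + t *\<^sub>R i))\<^sup>2) has_real_derivative
          2 * ((fst (z + t *\<^sub>R i) - x0) \<bullet> fst i) - 2 * b * snd (z + t *\<^sub>R i) * snd i) (at t)"
        unfolding power2_norm_eq_inner
        by (auto intro!: derivative_eq_intros simp: has_field_derivative_def inner_commute algebra_simps power2_eq_square)
      from DERIV_diff[OF w' DERIV_cmult[OF this, of c]] show ?thesis
        by (simp add: f_def g_def)
    qed
    have 2: "(g has_real_derivative H z i \<bullet> i - c * (2 * (norm (fst i))\<^sup>2 - 2 * b * (snd i)\<^sup>2)) (at 0)"
    proof -
      have "((\<lambda>t. 2 * ((fst (z + t *\<^sub>R i) - x0) \<bullet> fst i) - 2 * b * snd (z + t *\<^sub>R i) * snd i) has_real_derivative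
          2 * (norm (fst i))\<^sup>2 - 2 * b * (snd i)\<^sup>2) (at 0)"
        unfolding power2_norm_eq_inner
        by (auto intro!: derivative_eq_intros simp: has_field_derivative_def inner_commute algebra_simps power2_eq_square)
      from DERIV_diff[OF G_line_deriv[OF z] DERIV_cmult[OF this, of c]] show ?thesis
        by (simp add: g_def[abs_def])
    qed
    have 3: "f (z + t *\<^sub>R i) \<le> f (z + 0 *\<^sub>R i)" if "\<bar>t\<bar> < e'" for t
      using max[of "z + t *\<^sub>R i"] inball[OF that] e'(2) by (simp add: f_def)
    from second_derivative_nonpos_at_local_max[OF e'(1) 1 2 3] show ?thesis
      by (simp add: g_def)
  qed
  \<comment> \<open>Summing the second-order conditions over the basis contradicts the equation, whose first-order
    term is known because the gradient of the difference vanishes.\<close>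
  have e_y: "(0, 1) \<in> ?B" by (simp add: Basis_prod_def)
  have "(\<Sum>i\<in>?B. H z i \<bullet> i) \<le> (\<Sum>i\<in>?B. c * (2 - 2 * (1 + b) * (snd i)\<^sup>2))"
  proof (rule sum_mono)
    fix i assume i: "i \<in> ?B"
    have "(norm (fst i))\<^sup>2 + (snd i)\<^sup>2 = (norm i)\<^sup>2"
      by (simp add: norm_prod_def)
    then have n: "(norm (fst i))\<^sup>2 = 1 - (snd i)\<^sup>2" using i by simp
    have eq: "2 * (norm (fst i))\<^sup>2 - 2 * b * (snd i)\<^sup>2 = 2 - 2 * (1 + b) * (snd i)\<^sup>2"
      unfolding n by (simp add: algebra_simps)
    show "H z i \<bullet> i \<le> c * (2 - 2 * (1 + b) * (snd i)\<^sup>2)"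
      using key[OF i] unfolding eq by (rule conjunct2)
  qed
  also have "\<dots> = c * (2 * DIM((real ^ 'n) \<times> real) - 2 * (1 + b) * (\<Sum>i\<in>?B. (snd i)\<^sup>2))"
    unfolding sum_distrib_left[symmetric] sum_subtractf by simp
  also have "(\<Sum>i\<in>?B. (snd i)\<^sup>2) = (0, 1) \<bullet> ((0, 1) :: (real ^ 'n) \<times> real)"
    by (subst euclidean_inner) (auto simp: inner_prod_def power2_eq_square)
  finally have "(\<Sum>i\<in>?B. H z i \<bullet> i) \<le> 2 * c * (CARD('n) - b)"
    by (simp add: algebra_simps)
  moreover have "G z \<bullet> (0, 1) = - 2 * b * c * snd z"
    using key[OF e_y] by simp
  then have "a / snd z * (G z \<bullet> (0, 1)) = - (2 * a * b * c)" using y by simp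
  then have "(\<Sum>i\<in>?B. H z i \<bullet> i) = 2 * a * b * c" using pde[OF z] by linarith
  ultimately have "2 * a * b * c \<le> 2 * c * (CARD('n) - b)" by linarith
  then have "2 * c * ((1 + a) * b) \<le> 2 * c * CARD('n)" by (simp add: algebra_simps)
  moreover have "2 * c * CARD('n) < 2 * c * ((1 + a) * b)"
    using b c by (intro mult_strict_left_mono) auto
  ultimately show False by linarith
qed

end

text \<open>
  The weighted normal derivative is assumed to be strictly positive, so that \<open>w\<close> strictly increases
  when one leaves the boundary; this rules out boundary maxima without a Hopf lemma.
\<close>

locale La_subsolution = La_solution a w G H
  for a :: real and w :: "(real ^ 'n) \<times> real \<Rightarrow> real" and G H +
  assumes closed_pos: "\<And>z. z \<in> closed_half_space \<Longrightarrow> w z > 0"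
    and closed_cont: "continuous_on closed_half_space w"
    and flux: "\<And>x. \<exists>l>0. has_weighted_normal_deriv a w x l"
begin

lemma increasing_at_boundary:
  obtains e where "e > 0" "\<And>y. 0 < y \<Longrightarrow> y < e \<Longrightarrow> w (x, 0) < w (x, y)"
proof -
  obtain l where l: "l > 0" "((\<lambda>y. y powr a * deriv (\<lambda>t. w (x, t)) y) \<longlongrightarrow> l) (at_right 0)"
    using flux[of x] unfolding has_weighted_normal_deriv_def by blast
  have "\<forall>\<^sub>F y in at_right 0. 0 < y powr a * deriv (\<lambda>t. w (x, t)) y"
    by (rule order_tendstoD(1)[OF l(2,1)])
  then obtain e where e: "e > 0" "\<And>y. 0 < y \<Longrightarrow> y < e \<Longrightarrow> 0 < y powr a * deriv (\<lambda>t. w (x, t)) y"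
    unfolding eventually_at_right_field by auto
  have "w (x, 0) < w (x, y)" if y: "0 < y" "y < e" for y
  proof (rule DERIV_pos_imp_increasing_open[OF y(1), of "\<lambda>t. w (x, t)"])
    show "continuous_on {0..y} (\<lambda>t. w (x, t))"
      by (rule continuous_on_compose2[OF closed_cont])
         (auto intro!: continuous_intros simp: closed_half_space_def)
    fix t assume t: "0 < t" "t < y"
    have "(x, t) \<in> half_space" using t by (simp add: half_space_def)
    then have "((\<lambda>s. w (x, s)) has_derivative (\<lambda>h. G (x, t) \<bullet> (0, h))) (at t)"
      by (rule has_derivative_compose[OF _ w_deriv, rotated])
         (auto intro!: derivative_eq_intros)
    then have "(\<lambda>s. w (x, s)) differentiable (at t)" unfolding differentiable_def by blast
    then have "((\<lambda>s. w (x, s)) has_real_derivative deriv (\<lambda>s. w (x, s)) t) (at t)"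
      by (simp add: DERIV_deriv_iff_real_differentiable)
    moreover have "0 < deriv (\<lambda>s. w (x, s)) t"
      using e(2)[of t] t y by (simp add: zero_less_mult_iff)
    ultimately show "\<exists>d. ((\<lambda>s. w (x, s)) has_real_derivative d) (at t) \<and> 0 < d" by blast
  qed
  with e(1) show thesis by (rule that)
qed

text \<open>
  The barrier is \<open>M / 2 + c * ((norm (x - x0))\<^sup>2 + b * (\<delta>\<^sup>2 - y\<^sup>2))\<close> with \<open>c = Q * M / r\<^sup>2\<close>. It is at least \<open>M / 2\<close>
  on the lid and at least \<open>Q * M\<close> on the lateral side, and it decreases in \<open>y\<close>. At \<open>(x0, y0)\<close> it is less
  than \<open>M\<close> because the cylinder is thin. If \<open>w\<close> took the value \<open>M\<close> there, the difference of \<open>w\<close> and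
  the barrier would have a positive maximum over the cylinder, which can lie on no part of it.
\<close>

lemma thin_cylinder_comparison:
  fixes x0 :: "real ^ 'n"
  assumes r: "0 < r" and \<delta>: "0 < \<delta>" and M: "0 < M"
    and b: "(1 + a) * b > real CARD('n)" and thin: "2 * Q * b * \<delta>\<^sup>2 < r\<^sup>2" and Q: "Q > 0"
    and y0: "0 \<le> y0" "y0 < \<delta>" and M_eq: "w (x0, y0) = M"
    and side: "\<And>x y. norm (x - x0) \<le> r \<Longrightarrow> 0 \<le> y \<Longrightarrow> y \<le> \<delta> \<Longrightarrow> w (x, y) \<le> Q * M"
    and top: "\<And>x. norm (x - x0) \<le> r \<Longrightarrow> w (x, \<delta>) < M / 2"
  shows False
proof -
  have "(1 + a) * b > 0" using b by (rule le_less_trans[rotated]) simp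
  then have b0: "b > 0" using a by (simp add: zero_less_mult_iff)
  define c where "c = Q * M / r\<^sup>2"
  have c: "c > 0" using Q M r by (simp add: c_def)
  have cbd: "c * b * \<delta>\<^sup>2 < M / 2"
    using thin r M Q by (simp add: c_def field_simps)
  define f where "f z = w z - c * ((norm (fst z - x0))\<^sup>2 - b * (snd z)\<^sup>2)" for z
  define C where "C = cball x0 r \<times> {0..\<delta>}"
  have "C \<subseteq> closed_half_space" by (auto simp: C_def closed_half_space_def)
  then have "continuous_on C f"
    unfolding f_def by (intro continuous_intros continuous_on_subset[OF closed_cont])
  moreover have "compact C" unfolding C_def by (intro compact_Times) auto
  moreover have z0: "(x0, y0) \<in> C" using r y0 by (auto simp: C_def)
  ultimately obtain z1 where z1: "z1 \<in> C" "\<And>z. z \<in> C \<Longrightarrow> f z \<le> f z1"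
    using continuous_attains_sup[of C f] by blast
  obtain x1 y1 where xy: "z1 = (x1, y1)" by force
  have x1: "norm (x1 - x0) \<le> r" and y1: "0 \<le> y1" "y1 \<le> \<delta>"
    using z1(1) xy by (auto simp: C_def dist_norm norm_minus_commute)
  have "M \<le> f (x0, y0)" using c b0 by (simp add: f_def M_eq)
  then have fM: "M \<le> f z1" using z1(2)[OF z0] by linarith
  have ysq: "c * b * y1\<^sup>2 \<le> c * b * \<delta>\<^sup>2"
    using y1 c b0 by (intro mult_left_mono power_mono) auto
  have f1: "f z1 = w (x1, y1) - c * (norm (x1 - x0))\<^sup>2 + c * b * y1\<^sup>2"
    by (simp add: f_def xy algebra_simps)
  have "norm (x1 - x0) \<noteq> r"
  proof
    assume "norm (x1 - x0) = r"
    then have "c * (norm (x1 - x0))\<^sup>2 = Q * M" using r by (simp add: c_def)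
    then have "f z1 \<le> c * b * \<delta>\<^sup>2" using f1 side[OF x1 y1] ysq by linarith
    with cbd fM M show False by linarith
  qed
  then have x1': "norm (x1 - x0) < r" using x1 by simp
  have "y1 \<noteq> \<delta>"
  proof
    assume "y1 = \<delta>"
    moreover have "0 \<le> c * (norm (x1 - x0))\<^sup>2" using c by simp
    ultimately have "f z1 < M / 2 + c * b * \<delta>\<^sup>2" using f1 top[OF x1] ysq by simp
    with cbd fM show False by linarith
  qed
  then have y1': "y1 < \<delta>" using y1 by simp
  have "y1 \<noteq> 0"
  proof
    assume y10: "y1 = 0"
    obtain e where e: "e > 0" "\<And>y. 0 < y \<Longrightarrow> y < e \<Longrightarrow> w (x1, 0) < w (x1, y)"
      using increasing_at_boundary by blast
    define y where "y = min e \<delta> / 2"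
    have y: "0 < y" "y < e" "y \<le> \<delta>" using e \<delta> by (auto simp: y_def)
    have "(x1, y) \<in> C" using x1 y by (auto simp: C_def dist_norm norm_minus_commute)
    from z1(2)[OF this] have "f (x1, y) \<le> f z1" .
    moreover have "f (x1, y) = w (x1, y) - c * (norm (x1 - x0))\<^sup>2 + c * b * y\<^sup>2"
      by (simp add: f_def algebra_simps)
    moreover have "c * b * y\<^sup>2 \<ge> 0" using c b0 by simp
    ultimately show False using e(2)[OF y(1,2)] f1 y10 by simp
  qed
  then have y1'': "0 < y1" using y1 by simp
  have "z1 \<in> ball x0 r \<times> {0<..<\<delta>}"
    using x1' y1' y1'' xy by (auto simp: dist_norm norm_minus_commute)
  moreover have "open (ball x0 r \<times> {0<..<\<delta>})" by (intro open_Times) auto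
  ultimately obtain e where e: "e > 0" "ball z1 e \<subseteq> ball x0 r \<times> {0<..<\<delta>}"
    using open_contains_ball by metis
  show False
  proof (rule no_interior_max[OF _ c b e(1)])
    show "z1 \<in> half_space" using y1'' xy by (simp add: half_space_def)
    fix z' assume "z' \<in> ball z1 e"
    moreover have "ball x0 r \<times> {0<..<\<delta>} \<subseteq> C" by (auto simp: C_def)
    ultimately have "z' \<in> C" using e(2) by blast
    from z1(2)[OF this] show "w z' - c * ((norm (fst z' - x0))\<^sup>2 - b * (snd z')\<^sup>2)
        \<le> w z1 - c * ((norm (fst z1 - x0))\<^sup>2 - b * (snd z1)\<^sup>2)"
      by (simp add: f_def)
  qed
qed

text \<open>
  The blow-up rate \<open>m\<close> of the interior bound is also the exponent of the weight
  \<open>(2 * R - norm x) ^ m\<close>. At a maximum point of the weighted function, with \<open>d\<close> the distance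
  \<open>2 * R - norm x\<close>, the comparison on a thin cylinder gives \<open>M \<le> const * P * (R / d) ^ m\<close>, so the
  maximum itself is bounded by a multiple of \<open>P * R ^ m\<close> in which \<open>d\<close> has cancelled.
\<close>

lemma bound_up_to_boundary:
  assumes m: "m > 0"
  obtains C where "\<And>R P x y. R > 0 \<Longrightarrow>
      (\<And>x y. norm x \<le> 2 * R \<Longrightarrow> 0 < y \<Longrightarrow> y \<le> R \<Longrightarrow> w (x, y) \<le> P * (R / y) ^ m) \<Longrightarrow>
      norm x \<le> R \<Longrightarrow> 0 \<le> y \<Longrightarrow> y \<le> R \<Longrightarrow> w (x, y) \<le> C * P"
proof -
  define b where "b = (real CARD('n) + 1) / (1 + a)"
  have b: "(1 + a) * b > real CARD('n)" "b > 0" using a by (auto simp: b_def)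
  define q where "q = 2 * 2 ^ m * b"
  \<comment> \<open>The aspect ratio of the cylinder: the barrier argument needs \<open>2 * 2 ^ m * b * \<epsilon>\<^sup>2 < 1\<close>, where the
    factor \<open>2 ^ m\<close> is the oscillation of the weight over the width \<open>r = d / 2\<close>.\<close>
  define \<epsilon> where "\<epsilon> = 1 / (1 + q)"
  have q: "q > 0" using b by (simp add: q_def)
  have \<epsilon>: "0 < \<epsilon>" "\<epsilon> \<le> 1" using q by (auto simp: \<epsilon>_def)
  have "q * \<epsilon> < 1" using q by (simp add: \<epsilon>_def)
  then have "q * \<epsilon> * \<epsilon> < 1 * 1" using \<epsilon> q by (intro mult_less_le_imp_less) auto
  then have q\<epsilon>: "q * \<epsilon>\<^sup>2 < 1" by (simp add: power2_eq_square mult_ac)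
  have "w (x, y) \<le> 2 * (2 / \<epsilon>) ^ m * P"
    if R: "R > 0"
      and bd: "\<And>x y. norm x \<le> 2 * R \<Longrightarrow> 0 < y \<Longrightarrow> y \<le> R \<Longrightarrow> w (x, y) \<le> P * (R / y) ^ m"
      and xy: "norm x \<le> R" "0 \<le> y" "y \<le> R" for R P x y
  proof -
    define K where "K = cball (0 :: real ^ 'n) (2 * R) \<times> {0..R}"
    define \<Phi> where "\<Phi> z = w z * (2 * R - norm (fst z)) ^ m" for z
    have sub: "K \<subseteq> closed_half_space" by (auto simp: K_def closed_half_space_def)
    then have "continuous_on K \<Phi>"
      unfolding \<Phi>_def by (intro continuous_intros continuous_on_subset[OF closed_cont])
    moreover have "compact K" unfolding K_def by (intro compact_Times) auto
    moreover have K0: "(0, R) \<in> K" using R by (auto simp: K_def)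
    ultimately obtain z0 where z0: "z0 \<in> K" "\<And>z. z \<in> K \<Longrightarrow> \<Phi> z \<le> \<Phi> z0"
      using continuous_attains_sup[of K \<Phi>] by blast
    obtain x0 y0 where z0_eq: "z0 = (x0, y0)" by force
    have x0: "norm x0 \<le> 2 * R" and y0: "0 \<le> y0" "y0 \<le> R" using z0(1) z0_eq by (auto simp: K_def)
    define M where "M = w (x0, y0)"
    have M: "M > 0" unfolding M_def using closed_pos y0 by (simp add: closed_half_space_def)
    define d where "d = 2 * R - norm x0"
    have \<Phi>0: "\<Phi> z0 = M * d ^ m" by (simp add: \<Phi>_def M_def d_def z0_eq)
    have "0 < \<Phi> (0, R)" using closed_pos[of "(0, R)"] R by (simp add: \<Phi>_def closed_half_space_def)
    then have "0 < \<Phi> z0" using z0(2)[OF K0] by linarith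
    then have "d \<noteq> 0" using m by (auto simp: \<Phi>0 zero_power)
    then have d: "0 < d" "d \<le> 2 * R" using x0 by (auto simp: d_def)
    have P: "P > 0" using bd[of 0 R] closed_pos[of "(0, R)"] R by (simp add: closed_half_space_def)
    define r where "r = d / 2"
    define \<delta> where "\<delta> = \<epsilon> * r"
    have r: "0 < r" "r \<le> R" using d by (auto simp: r_def)
    have "\<delta> \<le> 1 * R" unfolding \<delta>_def using \<epsilon> r by (intro mult_mono) auto
    then have \<delta>: "0 < \<delta>" "\<delta> \<le> R" using \<epsilon> r by (auto simp: \<delta>_def)
    have M_le: "M \<le> 2 * (P * (R / \<delta>) ^ m)"
    proof (rule ccontr)
      assume "\<not> ?thesis"
      then have neg: "P * (R / \<delta>) ^ m < M / 2" by simp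
      have "y0 < \<delta>"
      proof (rule ccontr)
        assume "\<not> y0 < \<delta>"
        then have "M \<le> P * (R / y0) ^ m" unfolding M_def using bd x0 y0 \<delta> by simp
        also have "\<dots> \<le> P * (R / \<delta>) ^ m"
          using \<open>\<not> y0 < \<delta>\<close> P R \<delta> by (intro mult_left_mono power_mono divide_left_mono) auto
        finally show False using neg M by linarith
      qed
      have near: "norm x' \<le> 2 * R - r" if "norm (x' - x0) \<le> r" for x'
      proof -
        have "norm x' \<le> norm x0 + r" using norm_triangle_ineq[of x0 "x' - x0"] that by simp
        also have "norm x0 + r = 2 * R - r" by (simp add: r_def d_def field_simps)
        finally show ?thesis .
      qed
      show False
      proof (rule thin_cylinder_comparison[of r \<delta> M b "2 ^ m" y0 x0])
        have "2 * 2 ^ m * b * \<delta>\<^sup>2 = (q * \<epsilon>\<^sup>2) * r\<^sup>2"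
          by (simp add: q_def \<delta>_def power_mult_distrib)
        also have "\<dots> < 1 * r\<^sup>2" using q\<epsilon> r by (intro mult_strict_right_mono) auto
        finally show "2 * 2 ^ m * b * \<delta>\<^sup>2 < r\<^sup>2" by simp
      next
        fix x' assume x': "norm (x' - x0) \<le> r"
        then have "norm x' \<le> 2 * R" using near[OF x'] r by linarith
        then have "w (x', \<delta>) \<le> P * (R / \<delta>) ^ m" using bd \<delta> by simp
        then show "w (x', \<delta>) < M / 2" using neg by linarith
      next
        fix x' y' assume x': "norm (x' - x0) \<le> r" and y': "0 \<le> y'" "y' \<le> \<delta>"
        have K: "(x', y') \<in> K" using near[OF x'] r y' \<delta> by (auto simp: K_def)
        have wpos: "w (x', y') > 0" using closed_pos y' by (simp add: closed_half_space_def)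
        have "w (x', y') * r ^ m \<le> w (x', y') * (2 * R - norm x') ^ m"
          using near[OF x'] r wpos by (intro mult_left_mono power_mono) auto
        also have "\<dots> \<le> M * d ^ m" using z0(2)[OF K] \<Phi>0 by (simp add: \<Phi>_def)
        also have "\<dots> = (2 ^ m * M) * r ^ m" by (simp add: r_def power_divide)
        finally show "w (x', y') \<le> 2 ^ m * M" using r by simp
      qed (use r \<delta> M b y0 \<open>y0 < \<delta>\<close> in \<open>auto simp: M_def\<close>)
    qed
    have "w (x, y) * R ^ m \<le> w (x, y) * (2 * R - norm x) ^ m"
      using xy R closed_pos[of "(x, y)"] by (intro mult_left_mono power_mono) (auto simp: closed_half_space_def)
    also have "\<dots> \<le> M * d ^ m"
      using z0(2)[of "(x, y)"] xy R \<Phi>0 by (simp add: \<Phi>_def K_def)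
    also have "\<dots> \<le> 2 * (P * (R / \<delta>) ^ m) * d ^ m"
      using M_le d by (intro mult_right_mono) auto
    also have "\<dots> = 2 * P * (R / \<delta> * d) ^ m" by (simp only: power_mult_distrib mult.assoc)
    also have "R / \<delta> * d = 2 / \<epsilon> * R" using d \<epsilon> by (simp add: \<delta>_def r_def)
    also have "2 * P * (2 / \<epsilon> * R) ^ m = 2 * (2 / \<epsilon>) ^ m * P * R ^ m"
      by (simp only: power_mult_distrib mult_ac)
    finally show ?thesis using R by simp
  qed
  then show thesis by (rule that)
qed

lemma polynomial_growth:
  obtains k C where "C \<ge> 0" "\<And>x y. y > 0 \<Longrightarrow> w (x, y) \<le> C * (1 + norm x + \<bar>y\<bar>) ^ k"
proof -
  let ?K = harnack_const
  have K: "?K \<ge> 1" using harnack_const_ge_1 .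
  obtain m where m: "m > 0"
    and up: "\<And>x y Y. 0 < y \<Longrightarrow> y \<le> Y \<Longrightarrow> w (x, y) \<le> ?K * (Y / y) ^ m * w (x, Y)"
    and down: "\<And>x y Y. 0 < y \<Longrightarrow> y \<le> Y \<Longrightarrow> w (x, Y) \<le> ?K * (Y / y) ^ m * w (x, y)"
    using harnack_vertical_power by metis
  obtain C where C: "\<And>R P x y. R > 0 \<Longrightarrow>
      (\<And>x y. norm x \<le> 2 * R \<Longrightarrow> 0 < y \<Longrightarrow> y \<le> R \<Longrightarrow> w (x, y) \<le> P * (R / y) ^ m) \<Longrightarrow>
      norm x \<le> R \<Longrightarrow> 0 \<le> y \<Longrightarrow> y \<le> R \<Longrightarrow> w (x, y) \<le> C * P"
    using bound_up_to_boundary[OF m] by blast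
  \<comment> \<open>The exponent 32 is the number of sideways steps of length \<open>R / 16\<close> needed for the distance \<open>2 * R\<close>.\<close>
  define D where "D = \<bar>C\<bar> * (?K * ?K ^ 32 * (?K * w (0, 1)))"
  have w01: "w (0, 1) > 0" using pos by (simp add: half_space_def)
  have "D \<ge> 0" unfolding D_def using w01 K by simp
  moreover have "w (x, y) \<le> D * (1 + norm x + \<bar>y\<bar>) ^ m" if y: "y > 0" for x y
  proof -
    define R where "R = 1 + norm x + \<bar>y\<bar>"
    have R: "R \<ge> 1" "norm x \<le> R" "y \<le> R" "R > 0"
      unfolding R_def using norm_ge_zero[of x] by linarith+
    define P where "P = ?K * ?K ^ 32 * w (0, R)"
    have wR: "w (0, R) > 0" using pos R by (simp add: half_space_def)
    have "w (x, y) \<le> C * P"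
    proof (rule C[of R])
      fix x' :: "real ^ 'n" and y' assume x': "norm x' \<le> 2 * R" and y': "0 < y'" "y' \<le> R"
      have "w (x', y') \<le> ?K * (R / y') ^ m * w (x', R)" by (rule up[OF y'])
      also have "\<dots> \<le> ?K * (R / y') ^ m * (?K ^ 32 * w (0, R))"
        using x' R y' K by (intro mult_left_mono harnack_horizontal) auto
      finally show "w (x', y') \<le> P * (R / y') ^ m" by (simp add: P_def mult_ac)
    qed (use R y in auto)
    also have "\<dots> \<le> \<bar>C\<bar> * P" using wR K by (intro mult_right_mono) (auto simp: P_def)
    also have "\<dots> \<le> \<bar>C\<bar> * (?K * ?K ^ 32 * (?K * (R / 1) ^ m * w (0, 1)))"
      unfolding P_def using K R by (intro mult_left_mono down) auto
    also have "\<dots> = D * R ^ m" by (simp add: D_def mult_ac)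
    finally show ?thesis by (simp add: R_def)
  qed
  ultimately show thesis by (rule that)
qed

end

section \<open>Polynomial growth of solutions\<close>

theorem theorem1p2:
  fixes s a :: real
    and u v :: "(real ^ 'n) \<times> real \<Rightarrow> real"
  assumes "0 < s" and "s < 1" and "a = 1 - 2 * s"
    and "is_solution a u v"
  shows "\<exists>d > 0. \<exists>C. \<forall>(x, y) \<in> half_space.
           u (x, y) + v (x, y) \<le> C * (1 + norm x + \<bar>y\<bar>) powr d"
proof -
  have a: "-1 < a" using assms by auto
  have uv_pos: "u z > 0" "v z > 0" if "z \<in> closed_half_space" for z
    using assms(4) that unfolding is_solution_def by auto
  have growth: "\<exists>k C. C \<ge> 0 \<and> (\<forall>x y. y > 0 \<longrightarrow> w (x, y) \<le> C * (1 + norm x + \<bar>y\<bar>) ^ k)"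
    if w: "w \<in> {u, v}" for w
  proof -
    obtain G H where "La_solution a w G H"
      using is_solution_La_solution[OF a assms(4) w] .
    then interpret La_solution a w G H .
    interpret La_subsolution a w G H
    proof
      show "continuous_on closed_half_space w"
        using assms(4) w unfolding is_solution_def by blast
      show "\<exists>l>0. has_weighted_normal_deriv a w x l" for x
      proof -
        have "u (x, 0) > 0" "v (x, 0) > 0" using uv_pos by (auto simp: closed_half_space_def)
        then have "u (x, 0) * (v (x, 0))\<^sup>2 > 0" "v (x, 0) * (u (x, 0))\<^sup>2 > 0" by auto
        then show ?thesis using assms(4) w unfolding is_solution_def by blast
      qed
    qed (use uv_pos w in auto)
    show ?thesis by (rule polynomial_growth) blast
  qed
  obtain k1 C1 where 1: "C1 \<ge> 0" "\<And>x y. y > 0 \<Longrightarrow> u (x, y) \<le> C1 * (1 + norm x + \<bar>y\<bar>) ^ k1"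
    using growth[of u] by auto
  obtain k2 C2 where 2: "C2 \<ge> 0" "\<And>x y. y > 0 \<Longrightarrow> v (x, y) \<le> C2 * (1 + norm x + \<bar>y\<bar>) ^ k2"
    using growth[of v] by auto
  define k where "k = k1 + k2 + 1"
  show ?thesis
  proof (rule exI[of _ "real k"], intro conjI exI[of _ "C1 + C2"] ballI)
    show "real k > 0" by (simp add: k_def)
    fix z :: "(real ^ 'n) \<times> real" assume z: "z \<in> half_space"
    obtain x y where xy: "z = (x, y)" by force
    have y: "y > 0" using z xy by (simp add: half_space_def)
    define R where "R = 1 + norm x + \<bar>y\<bar>"
    have R: "R \<ge> 1" by (simp add: R_def)
    have "u (x, y) \<le> C1 * R ^ k1" "v (x, y) \<le> C2 * R ^ k2" using 1 2 y by (auto simp: R_def)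
    moreover have "k1 \<le> k" "k2 \<le> k" by (auto simp: k_def)
    then have "C1 * R ^ k1 \<le> C1 * R ^ k" "C2 * R ^ k2 \<le> C2 * R ^ k"
      using 1(1) 2(1) R by (auto intro!: mult_left_mono power_increasing)
    ultimately have "u (x, y) + v (x, y) \<le> (C1 + C2) * R ^ k" by (simp add: distrib_right)
    also have "R ^ k = R powr real k" using R by (simp add: powr_realpow)
    finally show "case z of (x, y) \<Rightarrow> u (x, y) + v (x, y) \<le> (C1 + C2) * (1 + norm x + \<bar>y\<bar>) powr real k"
      by (simp add: xy R_def)
  qed
qed

end
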